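(* Let $d=\sum_{j=1}^r d_j$ with $r\ge 3$, integers $d_j\ge 1$ for $j=1,\dots,r$, and $d-d_j-d_r\ge 2$ for $j=1,2,\dots,r-1$. Let $V,Y$ be complex-valued $\Gamma$-periodic functions on $\mathbb{Z}^d$. Assume that there exist $\lambda_1,\lambda_2\in\mathbb{C}$ such that $V$ and $Y$ are generalized Fermi isospectral, i.e. $P_V(k,\lambda_1)=P_Y(k,\lambda_2)$ for all $k\in\mathbb{R}^d$, and that $V$ and $Y$ are both $(d_1,d_2,\dots,d_{r-1})\oplus d_r$-separable, i.e. $$V(n)=\sum_{j=1}^{r-1}V_j(\tilde n_j,\tilde n_r),\qquad Y(n)=\sum_{j=1}^{r-1}Y_j(\tilde n_j,\tilde n_r)\qquad (n\in\mathbb{Z}^d)$$ for functions $V_j,Y_j:\mathbb{Z}^{d_j+d_r}\to\mathbb{C}$. Then for each $j=1,2,\dots,r-1$ there exist functions $U_{j;1},U_{j;2}:\mathbb{Z}^{d_r}\to\mathbb{C}$ such that $V_j(\tilde n_j,\tilde n_r)+U_{j;1}(\tilde n_r)$ and $Y_j(\tilde n_j,\tilde n_r)+U_{j;2}(\tilde n_r)$, as functions of $(\tilde n_j,\tilde n_r)\in\mathbb{Z}^{d_j+d_r}$, are Floquet isospectral.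
   Context: Let $q_1,\dots,q_d$ be pairwise coprime positive integers, $\Gamma=q_1\mathbb{Z}\oplus\cdots\oplus q_d\mathbb{Z}$, $Q=q_1q_2\cdots q_d$. A function $V:\mathbb{Z}^d\to\mathbb{C}$ is $\Gamma$-periodic if $V(n+\gamma)=V(n)$ for all $n\in\mathbb{Z}^d$, $\gamma\in\Gamma$. The discrete Laplacian is $(\Delta u)(n)=\sum_{\|n'-n\|=1}u(n')$ with $\|n'-n\|=\sum_{l=1}^d|n_l-n'_l|$. For $k=(k_1,\dots,k_d)$, the functions $u:\mathbb{Z}^d\to\mathbb{C}$ satisfying the Floquet-Bloch condition $u(n+q_j\mathbf{e}_j)=e^{2\pi \mathrm{i}k_j}u(n)$ for all $n\in\mathbb{Z}^d$, $j=1,\dots,d$ ($\mathbf{e}_j$ the standard basis) form a $Q$-dimensional space, each such $u$ being determined by its values on $W=\{n\in\mathbb{Z}^d:0\le n_j\le q_j-1,\ j=1,\dots,d\}$. For $\Gamma$-periodic $V$ the operator $\Delta+V$ preserves this space, and $D_V(k)$ denotes the $Q\times Q$ matrix of its restriction in the coordinates $(u(n))_{n\in W}$. Put $P_V(k,\lambda)=\det(D_V(k)-\lambda I)$. Blocks: put $d_0=0$ and, for $m=1,\dots,r$, $I_m=\{1+\sum_{j=0}^{m-1}d_j,\ 2+\sum_{j=0}^{m-1}d_j,\dots,\sum_{j=0}^{m}d_j\}$; for $n\in\mathbb{Z}^d$ let $\tilde n_m\in\mathbb{Z}^{d_m}$ be the vector of the components of $n$ with indices in $I_m$, so $n=(\tilde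 n_1,\dots,\tilde n_r)$. Floquet isospectrality: two periodic functions $V,Y$ (with the same period lattice) are Floquet isospectral if $P_V(k,\lambda)=P_Y(k,\lambda)$ for all real $k$ and all $\lambda\in\mathbb{C}$. For functions on $\mathbb{Z}^{d_j+d_r}$ of the variables $(\tilde n_j,\tilde n_r)$ this is understood in dimension $d_j+d_r$, with the period lattice $\bigoplus_{i\in I_j\cup I_r}q_i\mathbb{Z}$, the discrete Laplacian on $\mathbb{Z}^{d_j+d_r}$, and $k\in\mathbb{R}^{d_j+d_r}$; saying that two such functions are Floquet isospectral includes that they are periodic with respect to this lattice. *)

theory Defs
  imports
    Complex_Main
    "HOL-Library.FuncSet"
    "HOL-Library.Countable_Set"
    "Jordan_Normal_Form.Determinant"
begin

text \<open>
  Several dimensions occur in one statement, so the tuples over a finite index set \<open>S\<close> of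
  coordinates (for example \<open>\<int>\<^sup>d\<close>, with \<open>S = {1..d}\<close>) are the extensional functions on \<open>S\<close>, and the
  vector of the components of \<open>n\<close> with indices in \<open>T \<subseteq> S\<close> is \<open>restrict n T\<close>.  A function on
  \<open>\<int>\<^sup>S\<close> is a function on \<^typ>\<open>nat \<Rightarrow> int\<close>, of which only the values on \<open>tuples S\<close> matter.
\<close>

abbreviation tuples :: "nat set \<Rightarrow> (nat \<Rightarrow> 'a) set" where
  "tuples S \<equiv> S \<rightarrow>\<^sub>E UNIV"

definition period_lattice :: "nat set \<Rightarrow> (nat \<Rightarrow> nat) \<Rightarrow> (nat \<Rightarrow> int) set" where
  "period_lattice S q = {\<gamma> \<in> tuples S. \<forall>l\<in>S. int (q l) dvd \<gamma> l}"

definition lattice_periodic ::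
  "nat set \<Rightarrow> (nat \<Rightarrow> nat) \<Rightarrow> ((nat \<Rightarrow> int) \<Rightarrow> complex) \<Rightarrow> bool" where
  "lattice_periodic S q V \<longleftrightarrow>
     (\<forall>n\<in>tuples S. \<forall>\<gamma>\<in>period_lattice S q. V (\<lambda>l\<in>S. n l + \<gamma> l) = V n)"

definition l1_dist :: "nat set \<Rightarrow> (nat \<Rightarrow> int) \<Rightarrow> (nat \<Rightarrow> int) \<Rightarrow> int" where
  "l1_dist S n n' = (\<Sum>l\<in>S. \<bar>n l - n' l\<bar>)"

definition discrete_laplacian ::
  "nat set \<Rightarrow> ((nat \<Rightarrow> int) \<Rightarrow> complex) \<Rightarrow> (nat \<Rightarrow> int) \<Rightarrow> complex" where
  "discrete_laplacian S u n = (\<Sum>n' | n' \<in> tuples S \<and> l1_dist S n' n = 1. u n')"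

definition schroedinger ::
  "nat set \<Rightarrow> ((nat \<Rightarrow> int) \<Rightarrow> complex) \<Rightarrow> ((nat \<Rightarrow> int) \<Rightarrow> complex) \<Rightarrow> (nat \<Rightarrow> int) \<Rightarrow> complex" where
  "schroedinger S V u n = discrete_laplacian S u n + V n * u n"

definition floquet_space ::
  "nat set \<Rightarrow> (nat \<Rightarrow> nat) \<Rightarrow> (nat \<Rightarrow> real) \<Rightarrow> ((nat \<Rightarrow> int) \<Rightarrow> complex) set" where
  "floquet_space S q k =
     {u. \<forall>n\<in>tuples S. \<forall>j\<in>S. u (n(j := n j + int (q j))) = exp (2 * pi * \<i> * complex_of_real (k j)) * u n}"

definition fundamental_cell :: "nat set \<Rightarrow> (nat \<Rightarrow> nat) \<Rightarrow> (nat \<Rightarrow> int) set" where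
  "fundamental_cell S q = {n \<in> tuples S. \<forall>j\<in>S. 0 \<le> n j \<and> n j \<le> int (q j) - 1}"

text \<open>
  The element of \<^const>\<open>floquet_space\<close> with prescribed values \<open>f\<close> on the fundamental cell; see
  \<open>floquet_extension_in\<close>, \<open>floquet_extension_cell\<close> and \<open>floquet_space_determined\<close> below.
\<close>

definition floquet_extension ::
  "nat set \<Rightarrow> (nat \<Rightarrow> nat) \<Rightarrow> (nat \<Rightarrow> real) \<Rightarrow> ((nat \<Rightarrow> int) \<Rightarrow> complex) \<Rightarrow> (nat \<Rightarrow> int) \<Rightarrow> complex" where
  "floquet_extension S q k f n =
     exp (2 * pi * \<i> * complex_of_real (\<Sum>j\<in>S. k j * real_of_int (n j div int (q j)))) * f (\<lambda>j\<in>S. n j mod int (q j))"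

definition floquet_entry ::
  "nat set \<Rightarrow> (nat \<Rightarrow> nat) \<Rightarrow> ((nat \<Rightarrow> int) \<Rightarrow> complex) \<Rightarrow> (nat \<Rightarrow> real) \<Rightarrow>
   (nat \<Rightarrow> int) \<Rightarrow> (nat \<Rightarrow> int) \<Rightarrow> complex" where
  "floquet_entry S q V k w w' =
     schroedinger S V (floquet_extension S q k (\<lambda>n. if n = w' then 1 else 0)) w"

text \<open>
  The rows and columns of the matrix are labelled by the fundamental cell, which is enumerated by
  \<^const>\<open>from_nat_into\<close>; the determinant does not depend on the chosen enumeration.
\<close>

definition floquet_matrix ::
  "nat set \<Rightarrow> (nat \<Rightarrow> nat) \<Rightarrow> ((nat \<Rightarrow> int) \<Rightarrow> complex) \<Rightarrow> (nat \<Rightarrow> real) \<Rightarrow> complex mat" where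
  "floquet_matrix S q V k =
     (let W = fundamental_cell S q in
      mat (card W) (card W)
        (\<lambda>(a, b). floquet_entry S q V k (from_nat_into W a) (from_nat_into W b)))"

definition floquet_det ::
  "nat set \<Rightarrow> (nat \<Rightarrow> nat) \<Rightarrow> ((nat \<Rightarrow> int) \<Rightarrow> complex) \<Rightarrow> (nat \<Rightarrow> real) \<Rightarrow> complex \<Rightarrow> complex" where
  "floquet_det S q V k z =
     det (floquet_matrix S q V k - z \<cdot>\<^sub>m 1\<^sub>m (card (fundamental_cell S q)))"

definition floquet_isospectral ::
  "nat set \<Rightarrow> (nat \<Rightarrow> nat) \<Rightarrow> ((nat \<Rightarrow> int) \<Rightarrow> complex) \<Rightarrow> ((nat \<Rightarrow> int) \<Rightarrow> complex) \<Rightarrow> bool" where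
  "floquet_isospectral S q V Y \<longleftrightarrow>
     lattice_periodic S q V \<and> lattice_periodic S q Y \<and>
     (\<forall>k\<in>tuples S. \<forall>z. floquet_det S q V k z = floquet_det S q Y k z)"

definition generalized_fermi_isospectral ::
  "nat set \<Rightarrow> (nat \<Rightarrow> nat) \<Rightarrow> ((nat \<Rightarrow> int) \<Rightarrow> complex) \<Rightarrow> complex \<Rightarrow>
   ((nat \<Rightarrow> int) \<Rightarrow> complex) \<Rightarrow> complex \<Rightarrow> bool" where
  "generalized_fermi_isospectral S q V z\<^sub>1 Y z\<^sub>2 \<longleftrightarrow>
     (\<forall>k\<in>tuples S. floquet_det S q V k z\<^sub>1 = floquet_det S q Y k z\<^sub>2)"

definition block :: "(nat \<Rightarrow> nat) \<Rightarrow> nat \<Rightarrow> nat set" where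
  "block ds m = {1 + (\<Sum>j = 1..<m. ds j) .. \<Sum>j = 1..m. ds j}"

subsection \<open>The matrix represents the operator on the Floquet space\<close>

lemma finite_l1_sphere:
  assumes "finite S"
  shows "finite {n' \<in> tuples S. l1_dist S n' n = 1}"
proof (rule finite_subset)
  show "{n' \<in> tuples S. l1_dist S n' n = 1} \<subseteq> (\<Pi>\<^sub>E l\<in>S. {n l - 1..n l + 1})"
  proof safe
    fix n' l assume 1: "l1_dist S n' n = 1" and l: "l \<in> S"
    have "\<bar>n' l - n l\<bar> \<le> (\<Sum>l\<in>S. \<bar>n' l - n l\<bar>)"
      by (rule member_le_sum) (use l assms in auto)
    with 1 show "n' l \<in> {n l - 1..n l + 1}" by (auto simp: l1_dist_def)
  qed (auto simp: PiE_def extensional_def)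
  show "finite (\<Pi>\<^sub>E l\<in>S. {n l - 1..n l + 1})"
    using assms by (intro finite_PiE) auto
qed

lemma fundamental_cell_PiE: "fundamental_cell S q = (\<Pi>\<^sub>E j\<in>S. {0..int (q j) - 1})"
  by (auto simp: fundamental_cell_def PiE_def Pi_def)

lemma finite_fundamental_cell: "finite S \<Longrightarrow> finite (fundamental_cell S q)"
  unfolding fundamental_cell_PiE by (intro finite_PiE) auto

lemma card_fundamental_cell: "finite S \<Longrightarrow> card (fundamental_cell S q) = (\<Prod>j\<in>S. q j)"
  unfolding fundamental_cell_PiE by (simp add: card_PiE)

lemma mod_in_fundamental_cell:
  assumes "\<And>j. j \<in> S \<Longrightarrow> q j > 0"
  shows "(\<lambda>j\<in>S. n j mod int (q j)) \<in> fundamental_cell S q"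
  using assms unfolding fundamental_cell_PiE
  by (auto simp: PiE_iff zle_diff1_eq)

lemma floquet_extension_in:
  assumes S: "finite S" and q: "\<And>j. j \<in> S \<Longrightarrow> q j > 0"
  shows "floquet_extension S q k f \<in> floquet_space S q k"
  unfolding floquet_space_def
proof safe
  fix n :: "nat \<Rightarrow> int" and j assume j: "j \<in> S"
  let ?n = "n(j := n j + int (q j))"
  have "(\<lambda>l\<in>S. ?n l mod int (q l)) = (\<lambda>l\<in>S. n l mod int (q l))"
    by (auto simp: restrict_def fun_eq_iff)
  moreover have "(\<Sum>l\<in>S. k l * real_of_int (?n l div int (q l))) = k j + (\<Sum>l\<in>S. k l * real_of_int (n l div int (q l)))"
    using S j q[OF j] by (subst (1 2) sum.remove[of S j]) (auto simp: algebra_simps intro!: sum.cong)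
  ultimately show "floquet_extension S q k f ?n = exp (2 * pi * \<i> * complex_of_real (k j)) * floquet_extension S q k f n"
    by (simp add: floquet_extension_def algebra_simps flip: exp_add)
qed

lemma floquet_extension_cell:
  assumes "w \<in> fundamental_cell S q"
  shows "floquet_extension S q k f w = f w"
proof -
  have "(\<lambda>j\<in>S. w j mod int (q j)) = w"
    using assms by (auto simp: fundamental_cell_PiE restrict_def fun_eq_iff PiE_iff extensional_def)
  moreover have "(\<Sum>j\<in>S. k j * real_of_int (w j div int (q j))) = 0"
    using assms by (intro sum.neutral) (auto simp: fundamental_cell_PiE PiE_iff)
  ultimately show ?thesis by (simp add: floquet_extension_def)
qed

lemma floquet_space_shift:
  assumes u: "u \<in> floquet_space S q k" and n: "n \<in> tuples S" and j: "j \<in> S"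
  shows "u (n(j := n j + c * int (q j))) = exp (2 * pi * \<i> * complex_of_real (k j * real_of_int c)) * u n"
proof -
  define f where "f c = u (n(j := n j + c * int (q j)))" for c
  define E where "E c = exp (2 * pi * \<i> * complex_of_real (k j * real_of_int c))" for c
  have E: "E (c + 1) = exp (2 * pi * \<i> * complex_of_real (k j)) * E c" for c
    unfolding E_def by (simp add: algebra_simps flip: exp_add)
  have f: "f (c + 1) = exp (2 * pi * \<i> * complex_of_real (k j)) * f c" for c
  proof -
    let ?n = "n(j := n j + c * int (q j))"
    have "?n \<in> tuples S" using n j by (auto simp: PiE_iff extensional_def)
    with u j have "u (?n(j := ?n j + int (q j))) = exp (2 * pi * \<i> * complex_of_real (k j)) * u ?n"
      unfolding floquet_space_def by blast
    moreover have "?n(j := ?n j + int (q j)) = n(j := n j + (c + 1) * int (q j))"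
      by (simp add: algebra_simps)
    ultimately show ?thesis by (simp add: f_def)
  qed
  have "f c = E c * f 0"
  proof (induction c rule: int_induct[where k = 0])
    case base
    then show ?case by (simp add: E_def)
  next
    case (step1 c)
    then show ?case by (simp add: E f)
  next
    case (step2 c)
    then show ?case using E[of "c - 1"] f[of "c - 1"] by simp
  qed
  then show ?thesis by (simp add: f_def E_def)
qed

lemma floquet_space_determined:
  assumes S: "finite S" and u: "u \<in> floquet_space S q k" and n: "n \<in> tuples S"
  shows "u n = floquet_extension S q k u n"
proof -
  let ?m = "\<lambda>T l. if l \<in> T then n l mod int (q l) else n l"
  have "u n = exp (2 * pi * \<i> * complex_of_real (\<Sum>j\<in>T. k j * real_of_int (n j div int (q j)))) * u (?m T)" if "T \<subseteq> S" for T
    using finite_subset[OF that S] that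
  proof (induction T rule: finite_induct)
    case empty
    then show ?case by simp
  next
    case (insert j T)
    let ?m' = "?m (insert j T)"
    let ?E = "\<lambda>x. exp (2 * pi * \<i> * complex_of_real x)"
    let ?g = "\<lambda>j. k j * real_of_int (n j div int (q j))"
    have j: "j \<in> S" and T: "T \<subseteq> S" using insert.prems by auto
    have mem: "?m' \<in> tuples S"
      using n insert.prems by (auto simp: PiE_iff extensional_def)
    have "?m T = ?m'(j := ?m' j + (n j div int (q j)) * int (q j))"
      using insert.hyps by (simp add: fun_eq_iff)
    then have "u (?m T) = ?E (?g j) * u ?m'"
      by (simp only: floquet_space_shift[OF u mem j])
    then have "u n = ?E (sum ?g T) * (?E (?g j) * u ?m')"
      by (simp only: insert.IH[OF T])
    also have "\<dots> = ?E (?g j + sum ?g T) * u ?m'"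
      by (simp add: distrib_left exp_add)
    also have "?g j + sum ?g T = sum ?g (insert j T)"
      using insert.hyps by simp
    finally show ?case .
  qed
  from this[of S] have "u n = exp (2 * pi * \<i> * complex_of_real (\<Sum>j\<in>S. k j * real_of_int (n j div int (q j)))) * u (?m S)"
    by simp
  moreover have "?m S = (\<lambda>j\<in>S. n j mod int (q j))"
    using n by (auto simp: fun_eq_iff PiE_iff extensional_def)
  ultimately show ?thesis by (simp add: floquet_extension_def)
qed

lemma schroedinger_floquet_space:
  assumes S: "finite S" and V: "lattice_periodic S q V" and u: "u \<in> floquet_space S q k"
  shows "schroedinger S V u \<in> floquet_space S q k"
  unfolding floquet_space_def
proof safe
  fix n :: "nat \<Rightarrow> int" and j assume n: "n \<in> tuples S" and j: "j \<in> S"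
  let ?s = "\<lambda>n :: nat \<Rightarrow> int. n(j := n j + int (q j))"
  let ?t = "\<lambda>n :: nat \<Rightarrow> int. n(j := n j - int (q j))"
  let ?e = "exp (2 * pi * \<i> * complex_of_real (k j))"
  have us: "u (?s m) = ?e * u m" if "m \<in> tuples S" for m
    using u j that unfolding floquet_space_def by blast
  have "(\<lambda>l\<in>S. n l + (\<lambda>l\<in>S. if l = j then int (q j) else 0) l) = ?s n"
    using n j by (auto simp: fun_eq_iff PiE_iff extensional_def)
  moreover have "(\<lambda>l\<in>S. if l = j then int (q j) else 0) \<in> period_lattice S q"
    by (auto simp: period_lattice_def)
  ultimately have Vs: "V (?s n) = V n"
    using V n unfolding lattice_periodic_def by metis
  have dist: "l1_dist S (?s a) (?s b) = l1_dist S a b" for a b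
    unfolding l1_dist_def by (intro sum.cong) auto
  have ts: "?t (?s a) = a" "?s (?t a) = a" for a by auto
  have "(\<Sum>m | m \<in> tuples S \<and> l1_dist S m (?s n) = 1. u m) =
        (\<Sum>m | m \<in> tuples S \<and> l1_dist S m n = 1. u (?s m))"
  proof (rule sum.reindex_bij_witness[of _ ?s ?t])
    fix a assume a: "a \<in> {m. m \<in> tuples S \<and> l1_dist S m (?s n) = 1}"
    have "l1_dist S (?t a) n = l1_dist S a (?s n)"
      using dist[of "?t a" n] by (simp only: ts)
    then show "?t a \<in> {m. m \<in> tuples S \<and> l1_dist S m n = 1}"
      using a j by (auto simp: PiE_iff extensional_def)
  next
    fix b assume b: "b \<in> {m. m \<in> tuples S \<and> l1_dist S m n = 1}"
    have "?s b \<in> tuples S" using b j by (auto simp: PiE_iff extensional_def)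
    then show "?s b \<in> {m. m \<in> tuples S \<and> l1_dist S m (?s n) = 1}"
      using b dist by simp
  qed (simp_all only: ts)
  also have "\<dots> = ?e * (\<Sum>m | m \<in> tuples S \<and> l1_dist S m n = 1. u m)"
    unfolding sum_distrib_left by (intro sum.cong refl us) simp
  finally show "schroedinger S V u (?s n) = ?e * schroedinger S V u n"
    using us[OF n] Vs by (simp add: schroedinger_def discrete_laplacian_def algebra_simps)
qed

lemma schroedinger_eq_floquet_entry:
  assumes S: "finite S" and q: "\<And>j. j \<in> S \<Longrightarrow> q j > 0"
    and u: "u \<in> floquet_space S q k" and w: "w \<in> fundamental_cell S q"
  shows "schroedinger S V u w = (\<Sum>w'\<in>fundamental_cell S q. floquet_entry S q V k w w' * u w')"
proof -
  let ?W = "fundamental_cell S q"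
  let ?\<delta> = "\<lambda>w' n. if n = w' then 1 else 0 :: complex"
  have exp: "u n = (\<Sum>w'\<in>?W. floquet_extension S q k (?\<delta> w') n * u w')" if "n \<in> tuples S" for n
  proof -
    let ?m = "\<lambda>j\<in>S. n j mod int (q j)"
    let ?c = "exp (2 * pi * \<i> * complex_of_real (\<Sum>j\<in>S. k j * real_of_int (n j div int (q j))))"
    have "(\<Sum>w'\<in>?W. floquet_extension S q k (?\<delta> w') n * u w') =
          (\<Sum>w'\<in>?W. if ?m = w' then ?c * u w' else 0)"
      unfolding floquet_extension_def by (intro sum.cong) auto
    also have "\<dots> = ?c * u ?m"
      using finite_fundamental_cell[OF S, of q] mod_in_fundamental_cell[of S q n] q
      by (subst sum.delta') auto
    finally show ?thesis
      using floquet_space_determined[OF S u that] by (simp add: floquet_extension_def)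
  qed
  have wt: "w \<in> tuples S" using w by (simp add: fundamental_cell_def)
  have "discrete_laplacian S u w =
        (\<Sum>w'\<in>?W. discrete_laplacian S (floquet_extension S q k (?\<delta> w')) w * u w')"
    unfolding discrete_laplacian_def sum_distrib_right
    by (subst sum.swap) (intro sum.cong refl exp, simp)
  moreover have "V w * u w = (\<Sum>w'\<in>?W. V w * floquet_extension S q k (?\<delta> w') w * u w')"
    by (subst exp[OF wt]) (simp add: sum_distrib_left mult.assoc)
  ultimately show ?thesis
    by (simp add: schroedinger_def floquet_entry_def sum.distrib algebra_simps)
qed

end

theory Submission
  imports Defs "HOL-Complex_Analysis.Conformal_Mappings"
begin

text \<open>
  Fix \<open>j < r\<close> and split the coordinates into \<open>T = I\<^sub>j \<union> I\<^sub>r\<close> and its complement \<open>C\<close>, which has at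
  least two elements.  Averaging \<open>V\<close> over a period cell in the \<open>C\<close>-directions turns
  \<open>\<Sum>\<^sub>i V\<^sub>i(n\<^sub>i, n\<^sub>r)\<close> into \<open>V\<^sub>j(n\<^sub>j, n\<^sub>r)\<close> plus a function of \<open>n\<^sub>r\<close> alone, because for \<open>i \<noteq> j\<close> the
  variables in \<open>I\<^sub>i\<close> are averaged out (\<open>cell_mean_separable\<close>).  Hence it suffices that the averages
  of \<open>V\<close> and \<open>Y\<close>, shifted by \<open>-z\<^sub>1\<close> and \<open>-z\<^sub>2\<close>, are Floquet isospectral on \<open>\<int>\<^sup>T\<close>
  (\<open>floquet_isospectral_cell_mean\<close>).

  To isolate the average, expand in plane waves in the \<open>C\<close>-directions only.  With \<open>y\<^sub>l\<close> such that
  \<open>y\<^sub>l ^ q\<^sub>l = exp(2\<pi>ik\<^sub>l)\<close>, the Floquet matrix becomes a block matrix with blocks indexed by the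
  frequencies \<open>c, c'\<close> in the cell of \<open>C\<close> (\<open>floquet_det_eq_mixed\<close>).  The diagonal block \<open>c\<close> is the
  Floquet matrix on \<open>\<int>\<^sup>T\<close> of the average of \<open>V\<close>, plus the kinetic energy
  \<open>K\<^sub>c(y) = \<Sum>\<^sub>l \<rho>\<^sub>l y\<^sub>l + 1 / (\<rho>\<^sub>l y\<^sub>l)\<close> with \<open>\<rho>\<^sub>l = exp(2\<pi>ic\<^sub>l / q\<^sub>l)\<close>; the other blocks do not
  depend on \<open>y\<close>.  As the determinant is a Laurent polynomial in \<open>y\<close>, the identity of the
  determinants of \<open>V\<close> and \<open>Y\<close> on the torus \<open>|y\<^sub>l| = 1\<close> extends to all nonzero complex \<open>y\<^sub>l\<close>
  (\<open>mixed_det_eq_of_fermi\<close>).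

  Now send \<open>y\<close> to infinity along a path on which \<open>K\<^sub>0(y)\<close> keeps a prescribed value \<open>\<mu>\<close> while
  \<open>K\<^sub>c(y) \<rightarrow> \<infinity>\<close> for every other frequency \<open>c\<close> (\<open>kinetic_path\<close>).  Such a path exists since \<open>C\<close> has two
  elements and the periods are coprime: the linear forms \<open>\<Sum>\<^sub>l y\<^sub>l\<close> and \<open>\<Sum>\<^sub>l \<rho>\<^sub>l y\<^sub>l\<close> are proportional
  only if all \<open>\<rho>\<^sub>l\<close> coincide, and by coprimality this forces \<open>c = 0\<close>.  After division of each
  row by its diverging energy, only the block \<open>c = 0\<close> survives in the limit
  (\<open>mixed_det_tendsto\<close>), and its determinant is the Floquet determinant of the average at energy
  \<open>-\<mu>\<close>.  Since \<open>\<mu>\<close> is arbitrary, this gives the whole characteristic polynomial.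
\<close>

section \<open>Determinants over finite index sets\<close>

text \<open>
  The Leibniz formula over an arbitrary finite index set.  The Floquet matrix is naturally indexed
  by the period cell, and the argument reindexes it by pairs and restricts it to a block;
  an enumeration of the indices would have to be carried along.
\<close>

definition det_on :: "'i set \<Rightarrow> ('i \<Rightarrow> 'i \<Rightarrow> complex) \<Rightarrow> complex" where
  "det_on W f = (\<Sum>p | p permutes W. of_int (sign p) * (\<Prod>w\<in>W. f w (p w)))"

lemma det_on_cong:
  assumes "\<And>v w. v \<in> W \<Longrightarrow> w \<in> W \<Longrightarrow> f v w = g v w"
  shows "det_on W f = det_on W g"
  unfolding det_on_def
proof (rule sum.cong[OF refl])
  fix p assume "p \<in> {p. p permutes W}"
  then have p: "p permutes W" by simp
  have "(\<Prod>w\<in>W. f w (p w)) = (\<Prod>w\<in>W. g w (p w))"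
    by (intro prod.cong refl assms) (auto simp: permutes_in_image[OF p])
  then show "of_int (sign p) * (\<Prod>w\<in>W. f w (p w)) = of_int (sign p) * (\<Prod>w\<in>W. g w (p w))"
    by simp
qed

lemma det_on_reindex:
  assumes \<beta>: "bij_betw \<beta> A B" and A: "finite A"
  shows "det_on A (\<lambda>a a'. f (\<beta> a) (\<beta> a')) = det_on B f"
proof -
  define \<alpha> where "\<alpha> = inv_into A \<beta>"
  have \<alpha>: "bij_betw \<alpha> B A" unfolding \<alpha>_def by (rule bij_betw_inv_into[OF \<beta>])
  have inj: "inj_on \<beta> A" "inj_on \<alpha> B" using \<alpha> \<beta> by (auto simp: bij_betw_def)
  have [simp]: "\<alpha> (\<beta> a) = a" if "a \<in> A" for a
    using that \<beta> unfolding \<alpha>_def by (simp add: bij_betw_inv_into_left)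
  have [simp]: "\<beta> (\<alpha> b) = b" if "b \<in> B" for b
    using that \<beta> unfolding \<alpha>_def by (simp add: bij_betw_inv_into_right)
  show ?thesis
    unfolding det_on_def
  proof (rule sum.reindex_bij_witness[of _ "map_permutation B \<alpha>" "map_permutation A \<beta>"])
    fix p assume "p \<in> {p. p permutes A}"
    then have p: "p permutes A" by simp
    show "map_permutation B \<alpha> (map_permutation A \<beta> p) = p"
      by (rule map_permutation_compose_inv[OF \<beta> p]) simp
    show "map_permutation A \<beta> p \<in> {p. p permutes B}"
      using map_permutation_permutes[OF \<beta> p] by simp
    have "(\<Prod>b\<in>B. f b (map_permutation A \<beta> p b)) = (\<Prod>a\<in>A. f (\<beta> a) (map_permutation A \<beta> p (\<beta> a)))"
      by (rule prod.reindex_bij_betw[OF \<beta>, symmetric])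
    then show "of_int (sign (map_permutation A \<beta> p)) * (\<Prod>b\<in>B. f b (map_permutation A \<beta> p b)) =
        of_int (sign p) * (\<Prod>a\<in>A. f (\<beta> a) (\<beta> (p a)))"
      by (simp add: sign_map_permutation[OF inj(1) p A] map_permutation_apply[OF inj(1)])
  next
    fix p assume "p \<in> {p. p permutes B}"
    then have p: "p permutes B" by simp
    show "map_permutation A \<beta> (map_permutation B \<alpha> p) = p"
      by (rule map_permutation_compose_inv[OF \<alpha> p]) simp
    show "map_permutation B \<alpha> p \<in> {p. p permutes A}"
      using map_permutation_permutes[OF \<alpha> p] by simp
  qed
qed

lemma det_mat_eq_det_on: "Determinant.det (Matrix.mat n n (\<lambda>(a, b). f a b)) = det_on {0..<n} f"
  unfolding Determinant.det_def det_on_def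
  by (auto intro!: sum.cong prod.cong dest: permutes_in_image)

lemma det_on_eq_det_mat:
  assumes "finite W"
  obtains e where "bij_betw e {0..<card W} W"
    "\<And>f. det_on W f = Determinant.det (Matrix.mat (card W) (card W) (\<lambda>(a, b). f (e a) (e b)))"
proof -
  obtain e where e: "bij_betw e {0..<card W} W" using ex_bij_betw_nat_finite[OF assms] by blast
  then show thesis by (intro that[of e]) (simp_all add: det_mat_eq_det_on det_on_reindex)
qed

lemma det_on_mult:
  assumes W: "finite W"
  shows "det_on W (\<lambda>v w. \<Sum>x\<in>W. f v x * g x w) = det_on W f * det_on W g"
proof -
  define n where "n = card W"
  obtain e where e: "bij_betw e {0..<n} W"
    and d: "\<And>f. det_on W f = Determinant.det (Matrix.mat n n (\<lambda>(a, b). f (e a) (e b)))"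
    using det_on_eq_det_mat[OF W] unfolding n_def by metis
  let ?M = "\<lambda>f. Matrix.mat n n (\<lambda>(a, b). f (e a) (e b))"
  have "?M (\<lambda>v w. \<Sum>x\<in>W. f v x * g x w) = ?M f * ?M g"
    by (rule eq_matI) (simp_all add: scalar_prod_def sum.reindex_bij_betw[OF e, symmetric])
  then show ?thesis
    unfolding d by (simp add: det_mult[where n = n])
qed

lemma det_on_one:
  assumes W: "finite W"
  shows "det_on W (\<lambda>v w. of_bool (v = w)) = 1"
proof -
  define n where "n = card W"
  obtain e where e: "bij_betw e {0..<n} W"
    and d: "\<And>f. det_on W f = Determinant.det (Matrix.mat n n (\<lambda>(a, b). f (e a) (e b)))"
    using det_on_eq_det_mat[OF W] unfolding n_def by metis
  have "Matrix.mat n n (\<lambda>(a, b). of_bool (e a = e b)) = (1\<^sub>m n :: complex mat)"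
    using e by (intro eq_matI) (auto simp: bij_betw_def inj_on_def)
  then show ?thesis unfolding d by simp
qed

text \<open>
  The left inverse property of \<open>G\<close> is enough: it already makes the determinants of \<open>G\<close> and \<open>F\<close>
  inverse to each other.
\<close>

lemma det_on_similar:
  assumes W: "finite W"
    and inv: "\<And>v w. v \<in> W \<Longrightarrow> w \<in> W \<Longrightarrow> (\<Sum>x\<in>W. G v x * F x w) = of_bool (v = w)"
  shows "det_on W (\<lambda>v w. \<Sum>x\<in>W. G v x * (\<Sum>y\<in>W. f x y * F y w)) = det_on W f"
proof -
  have "det_on W G * det_on W F = 1"
    using det_on_cong[of W _ "\<lambda>v w. of_bool (v = w)", OF inv] by (simp add: det_on_mult W det_on_one)
  then have "det_on W G * (det_on W f * det_on W F) = det_on W f"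
    by (metis mult.commute mult.left_commute mult.right_neutral)
  then show ?thesis by (simp only: det_on_mult[OF W])
qed

lemma det_on_scale_rows:
  "det_on W (\<lambda>v w. s v * f v w) = (\<Prod>v\<in>W. s v) * det_on W f"
  unfolding det_on_def by (simp add: prod.distrib sum_distrib_left mult_ac)

text \<open>
  A permutation that contributes to the determinant has to fix every index of a unit row, so it
  is a permutation of the remaining indices.
\<close>

lemma det_on_unit_rows:
  assumes W: "finite W" and sub: "W' \<subseteq> W"
    and unit: "\<And>v w. v \<in> W - W' \<Longrightarrow> w \<in> W \<Longrightarrow> f v w = of_bool (v = w)"
  shows "det_on W f = det_on W' f"
proof -
  have "(\<Sum>p | p permutes W. of_int (sign p) * (\<Prod>w\<in>W. f w (p w))) =
        (\<Sum>p | p permutes W'. of_int (sign p) * (\<Prod>w\<in>W. f w (p w)))"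
  proof (rule sum.mono_neutral_right)
    show "finite {p. p permutes W}" by (rule finite_permutations[OF W])
    show "{p. p permutes W'} \<subseteq> {p. p permutes W}" using permutes_subset[OF _ sub] by auto
    show "\<forall>p\<in>{p. p permutes W} - {p. p permutes W'}. of_int (sign p) * (\<Prod>w\<in>W. f w (p w)) = 0"
    proof
      fix p assume p: "p \<in> {p. p permutes W} - {p. p permutes W'}"
      then obtain v where v: "v \<in> W - W'" "p v \<noteq> v"
        using permutes_superset[of p W W'] by auto
      moreover have "p v \<in> W" using p v by (auto simp: permutes_in_image)
      ultimately have "f v (p v) = 0" using unit by auto
      then have "(\<Prod>w\<in>W. f w (p w)) = 0" using v W by auto
      then show "of_int (sign p) * (\<Prod>w\<in>W. f w (p w)) = 0" by simp
    qed
  qed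
  also have "\<dots> = (\<Sum>p | p permutes W'. of_int (sign p) * (\<Prod>w\<in>W'. f w (p w)))"
  proof (intro sum.cong refl)
    fix p assume "p \<in> {p. p permutes W'}"
    then have "f w (p w) = 1" if "w \<in> W - W'" for w
      using that unit[of w w] by (auto simp: permutes_not_in)
    then have "(\<Prod>w\<in>W. f w (p w)) = (\<Prod>w\<in>W'. f w (p w))"
      by (intro prod.mono_neutral_right W sub) auto
    then show "of_int (sign p) * (\<Prod>w\<in>W. f w (p w)) = of_int (sign p) * (\<Prod>w\<in>W'. f w (p w))" by simp
  qed
  finally show ?thesis unfolding det_on_def .
qed

lemma tendsto_det_on:
  assumes "\<And>v w. v \<in> W \<Longrightarrow> w \<in> W \<Longrightarrow> ((\<lambda>t. f t v w) \<longlongrightarrow> g v w) F"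
  shows "((\<lambda>t. det_on W (f t)) \<longlongrightarrow> det_on W g) F"
  unfolding det_on_def
  by (intro tendsto_sum tendsto_mult tendsto_const tendsto_prod assms) (auto simp: permutes_in_image)

lemma holomorphic_det_on:
  assumes "\<And>v w. v \<in> W \<Longrightarrow> w \<in> W \<Longrightarrow> (\<lambda>t. f t v w) holomorphic_on A"
  shows "(\<lambda>t. det_on W (f t)) holomorphic_on A"
  unfolding det_on_def
  by (intro holomorphic_on_sum holomorphic_on_mult holomorphic_on_const holomorphic_on_prod assms) (auto simp: permutes_in_image)

section \<open>Continuation off the torus and the path to infinity\<close>

text \<open>
  The coordinates are freed from the unit circle one at a time: in each step the identity
  theorem is applied on the punctured plane to a function of a single variable that vanishes on
  the unit circle.
\<close>

lemma zero_on_torus_imp_zero: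
  fixes g :: "('i \<Rightarrow> complex) \<Rightarrow> complex"
  assumes C: "finite C"
    and holo: "\<And>y l. l \<in> C \<Longrightarrow> (\<forall>m\<in>C. y m \<noteq> 0) \<Longrightarrow> (\<lambda>t. g (y(l := t))) holomorphic_on - {0}"
    and torus: "\<And>y. (\<forall>l\<in>C. norm (y l) = 1) \<Longrightarrow> g y = 0"
    and y: "\<forall>l\<in>C. y l \<noteq> 0"
  shows "g y = 0"
proof -
  have "g y = 0" if "B \<subseteq> C" "\<forall>l\<in>C. y l \<noteq> 0" "\<forall>l\<in>C - B. norm (y l) = 1" for B y
    using finite_subset[OF that(1) C] that
  proof (induction B arbitrary: y rule: finite_induct)
    case empty
    then show ?case using torus by simp
  next
    case (insert l B)
    have l: "l \<in> C" using insert.prems by simp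
    have "g (y(l := y l)) = 0"
    proof (rule analytic_continuation[where f = "\<lambda>t. g (y(l := t))" and U = "sphere 0 1" and \<xi> = 1])
      show "(\<lambda>t. g (y(l := t))) holomorphic_on - {0}"
        by (rule holo[OF l insert.prems(2)])
      show "connected (- {0::complex})" by (simp add: connected_punctured_universe)
      show "1 islimpt sphere (0::complex) 1"
      proof (rule connected_imp_perfect)
        show "connected (sphere (0::complex) 1)" by (rule connected_sphere) simp
        show "sphere (0::complex) 1 \<noteq> {x}" for x
        proof
          assume "sphere (0::complex) 1 = {x}"
          moreover have "(1::complex) \<in> sphere 0 1" "(-1::complex) \<in> sphere 0 1" by simp_all
          ultimately have "(1::complex) = -1" by simp
          then show False by simp
        qed
      qed simp
      show "g (y(l := t)) = 0" if "t \<in> sphere 0 1" for t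
        by (rule insert.IH) (use insert.prems insert.hyps that in auto)
    qed (use insert.prems l in auto)
    then show ?case by simp
  qed
  from this[of C y] y show ?thesis by simp
qed

definition unit_root :: "nat \<Rightarrow> int \<Rightarrow> complex" where
  "unit_root N c = exp (2 * pi * \<i> * complex_of_real (real_of_int c / real N))"

lemma norm_unit_root [simp]: "norm (unit_root N c) = 1"
  by (simp add: unit_root_def)

lemma unit_root_nonzero [simp]: "unit_root N c \<noteq> 0"
  by (simp add: unit_root_def)

lemma unit_root_0 [simp]: "unit_root N 0 = 1"
  by (simp add: unit_root_def)

text \<open>
  A root of unity whose order divides two coprime numbers is \<open>1\<close>.
\<close>

lemma unit_root_eq_imp_zero:
  assumes cop: "coprime N M" and a: "0 \<le> a" "a < int N" and b: "0 \<le> b" "b < int M"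
    and eq: "unit_root N a = unit_root M b"
  shows "a = 0 \<and> b = 0"
proof -
  have pos: "real N > 0" "real M > 0" using a b by auto
  obtain m :: int where "2 * pi * \<i> * complex_of_real (real_of_int a / real N) =
      2 * pi * \<i> * complex_of_real (real_of_int b / real M) + (of_int (2 * m) * pi) * \<i>"
    using eq unfolding unit_root_def exp_eq by blast
  then have "(2 * pi * \<i>) * complex_of_real (real_of_int a / real N) =
      (2 * pi * \<i>) * complex_of_real (real_of_int b / real M + real_of_int m)"
    by (simp add: algebra_simps)
  then have "complex_of_real (real_of_int a / real N) = complex_of_real (real_of_int b / real M + real_of_int m)"
    by (subst (asm) mult_cancel_left) simp
  then have "real_of_int a / real N = real_of_int b / real M + real_of_int m"
    by (simp only: of_real_eq_iff)
  then have "real_of_int (a * int M) = real_of_int (b * int N + m * int N * int M)"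
    using pos by (simp add: field_simps)
  then have e: "a * int M = b * int N + m * int N * int M" by (simp only: of_int_eq_iff)
  have "int N dvd a * int M" unfolding e by simp
  moreover have "b * int N = int M * (a - m * int N)" using e by (simp add: algebra_simps)
  then have "int M dvd b * int N" by simp
  ultimately have "int N dvd a" "int M dvd b"
    using cop by (simp_all add: coprime_dvd_mult_left_iff coprime_commute)
  then show ?thesis using a b by (auto dest: zdvd_imp_le)
qed

text \<open>
  The two solutions of \<open>y + 1 / y = \<sigma>\<close> are the roots of \<open>y\<^sup>2 - \<sigma>y + 1\<close>; their product is \<open>1\<close>, so one
  of them lies outside the open unit disc.
\<close>

lemma joukowski_preimage:
  fixes \<sigma> :: complex
  obtains y where "norm y \<ge> 1" "y + 1 / y = \<sigma>"
proof -
  define s where "s = csqrt (\<sigma>\<^sup>2 - 4)"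
  define u v where "u = (\<sigma> + s) / 2" and "v = (\<sigma> - s) / 2"
  have "u * v = 1" and sum: "u + v = \<sigma>"
    by (simp_all add: u_def v_def field_simps s_def flip: power2_eq_square)
  then have "u \<noteq> 0" "v \<noteq> 0" and nm: "norm u * norm v = 1"
    by (auto simp flip: norm_mult)
  with \<open>u * v = 1\<close> have inv: "1 / u = v" "1 / v = u" by (simp_all add: divide_eq_eq mult.commute)
  have "norm u \<ge> 1 \<or> norm v \<ge> 1"
  proof (rule ccontr)
    assume "\<not> ?thesis"
    then have "norm u * norm v < 1 * 1" by (intro mult_strict_mono) auto
    with nm show False by simp
  qed
  then show thesis using that[of u] that[of v] inv sum by (auto simp: add.commute)
qed

text \<open>
  The eigenvalue of the Laplacian in the \<open>C\<close>-directions on the plane wave of frequency \<open>c\<close>.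
\<close>

definition kinetic :: "nat set \<Rightarrow> (nat \<Rightarrow> nat) \<Rightarrow> (nat \<Rightarrow> int) \<Rightarrow> (nat \<Rightarrow> complex) \<Rightarrow> complex" where
  "kinetic C q c y = (\<Sum>l\<in>C. unit_root (q l) (c l) * y l + 1 / (unit_root (q l) (c l) * y l))"

text \<open>
  Pick \<open>p \<in> C\<close>, let the other variables grow like distinct powers, \<open>y\<^sub>l = t ^ (l + 1)\<close>, and choose
  \<open>y\<^sub>p\<close> with \<open>norm y\<^sub>p \<ge> 1\<close> so that the energy of frequency \<open>0\<close> is exactly \<open>\<mu>\<close>.  Eliminating \<open>y\<^sub>p\<close>, the
  energy of frequency \<open>c\<close> is \<open>\<Sum>\<^sub>l (\<rho>\<^sub>l - \<rho>\<^sub>p) t ^ (l + 1)\<close> up to a bounded error.  Distinct exponents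
  exclude cancellation, so it diverges unless all \<open>\<rho>\<^sub>l\<close> are equal to \<open>\<rho>\<^sub>p\<close>, which for coprime
  periods means \<open>c = 0\<close>.
\<close>

lemma kinetic_path:
  fixes \<mu> :: complex
  assumes C: "finite C" "card C \<ge> 2"
    and cop: "pairwise (\<lambda>i j. coprime (q i) (q j)) C"
  obtains y :: "nat \<Rightarrow> nat \<Rightarrow> complex" where
    "\<And>t l. l \<in> C \<Longrightarrow> y t l \<noteq> 0"
    "\<And>t. kinetic C q (\<lambda>l\<in>C. 0) (y t) = \<mu>"
    "\<And>c. c \<in> fundamental_cell C q \<Longrightarrow> c \<noteq> (\<lambda>l\<in>C. 0) \<Longrightarrow>
       filterlim (\<lambda>t. kinetic C q c (y t)) at_infinity sequentially"
proof -
  obtain p where p: "p \<in> C" using C by fastforce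
  define C' where "C' = C - {p}"
  have C': "finite C'" "C' \<noteq> {}" "p \<notin> C'" "C = insert p C'"
    using C p card_mono[of "{p}" C] by (auto simp: C'_def)
  define T where "T t = (of_nat (Suc t) :: complex)" for t
  have T: "norm (T t) \<ge> 1" "T t \<noteq> 0" for t
    unfolding T_def by (simp_all only: norm_of_nat of_nat_eq_0_iff)
  have T0: "T t ^ k \<noteq> 0" for t k using T by simp
  define \<sigma> where "\<sigma> t = \<mu> - (\<Sum>l\<in>C'. T t ^ Suc l + 1 / T t ^ Suc l)" for t
  have "\<exists>z. norm z \<ge> 1 \<and> z + 1 / z = \<sigma> t" for t
    using joukowski_preimage[of "\<sigma> t"] by metis
  then obtain z where z: "\<And>t. norm (z t) \<ge> 1" "\<And>t. z t + 1 / z t = \<sigma> t" by metis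
  have z0: "z t \<noteq> 0" for t using z(1)[of t] by auto
  define y where "y t l = (if l = p then z t else T t ^ Suc l)" for t l
  have kin: "kinetic C q c (y t) =
      (unit_root (q p) (c p) * z t + 1 / (unit_root (q p) (c p) * z t)) +
      (\<Sum>l\<in>C'. unit_root (q l) (c l) * T t ^ Suc l + 1 / (unit_root (q l) (c l) * T t ^ Suc l))" for c t
    unfolding kinetic_def C'(4) sum.insert[OF C'(1,3)]
    by (intro arg_cong2[of _ _ _ _ "(+)"] sum.cong refl) (use C'(3) in \<open>auto simp: y_def\<close>)
  show thesis
  proof (rule that[of y])
    show "y t l \<noteq> 0" for t l using z0 T0[of t "Suc l"] by (simp add: y_def del: power_Suc)
    show "kinetic C q (\<lambda>l\<in>C. 0) (y t) = \<mu>" for t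
    proof -
      have "kinetic C q (\<lambda>l\<in>C. 0) (y t) = (z t + 1 / z t) + (\<Sum>l\<in>C'. T t ^ Suc l + 1 / T t ^ Suc l)"
        unfolding kin by (intro arg_cong2[of _ _ _ _ "(+)"] sum.cong) (auto simp: C'(4))
      then show ?thesis unfolding z(2) \<sigma>_def by simp
    qed
  next
    fix c assume c: "c \<in> fundamental_cell C q" "c \<noteq> (\<lambda>l\<in>C. 0)"
    have range: "0 \<le> c l" "c l < int (q l)" if "l \<in> C" for l
      using c(1) that unfolding fundamental_cell_def by auto
    define \<rho> where "\<rho> l = unit_root (q l) (c l)" for l
    have \<rho>: "norm (\<rho> l) = 1" "\<rho> l \<noteq> 0" for l by (simp_all add: \<rho>_def)
    \<comment> \<open>This is where coprimality and the existence of a second index in \<open>C\<close> are needed.\<close>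
    have "\<exists>l\<in>C'. \<rho> l \<noteq> \<rho> p"
    proof (rule ccontr)
      assume "\<not> ?thesis"
      then have eq: "\<rho> l = \<rho> p" if "l \<in> C'" for l using that by blast
      have "c l = 0 \<and> c p = 0" if l: "l \<in> C'" for l
      proof (rule unit_root_eq_imp_zero)
        show "coprime (q l) (q p)" using cop l p C' by (auto simp: pairwise_def)
        show "unit_root (q l) (c l) = unit_root (q p) (c p)" using eq[OF l] by (simp add: \<rho>_def)
      qed (use range p l C' in auto)
      then have "c l = 0" if "l \<in> C" for l using that C' by auto
      then have "c = (\<lambda>l\<in>C. 0)"
        using c(1) by (auto simp: fundamental_cell_def fun_eq_iff PiE_iff extensional_def)
      with c(2) show False by simp
    qed
    then obtain h where h: "h \<in> C'" "\<rho> h \<noteq> \<rho> p" by blast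
    define K where "K = Max C'"
    have K: "l \<le> K" if "l \<in> C'" for l using that C' by (simp add: K_def)
    \<comment> \<open>The leading part of the energy as a polynomial in \<open>t\<close>, and the bounded rest.\<close>
    define a where "a i = (if i \<in> Suc ` C' then \<rho> (i - 1) - \<rho> p else 0)" for i
    define P where "P x = (\<Sum>i\<le>Suc K. a i * x ^ i)" for x
    define R where "R t = (\<Sum>l\<in>C'. 1 / (\<rho> l * T t ^ Suc l) - \<rho> p / T t ^ Suc l) + \<rho> p * \<mu>
        + (1 / \<rho> p - \<rho> p) / z t" for t
    have P: "P x = (\<Sum>l\<in>C'. (\<rho> l - \<rho> p) * x ^ Suc l)" for x
    proof -
      have "P x = (\<Sum>i\<in>Suc ` C'. a i * x ^ i)"
        unfolding P_def by (intro sum.mono_neutral_right) (use K in \<open>auto simp: a_def\<close>)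
      also have "\<dots> = (\<Sum>l\<in>C'. (\<rho> l - \<rho> p) * x ^ Suc l)"
        by (subst sum.reindex) (auto simp: a_def)
      finally show ?thesis .
    qed
    have split: "kinetic C q c (y t) = P (T t) + R t" for t
    proof -
      \<comment> \<open>The unknown \<open>z t\<close> is replaced by \<open>\<sigma> t\<close> and its own inverse, which is bounded by \<open>1\<close>.\<close>
      have "\<rho> p * z t = \<rho> p * \<sigma> t - \<rho> p / z t"
        using z0 by (simp flip: z(2) add: field_simps)
      then have "\<rho> p * z t + 1 / (\<rho> p * z t) = \<rho> p * \<sigma> t + (1 / \<rho> p - \<rho> p) / z t"
        by (simp add: diff_divide_distrib)
      then have "kinetic C q c (y t) = \<rho> p * \<sigma> t + (1 / \<rho> p - \<rho> p) / z t +
          (\<Sum>l\<in>C'. \<rho> l * T t ^ Suc l + 1 / (\<rho> l * T t ^ Suc l))"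
        unfolding kin \<rho>_def[symmetric] by simp
      then show ?thesis
        unfolding P R_def \<sigma>_def
        by (simp add: algebra_simps sum.distrib sum_subtractf sum_distrib_left del: power_Suc)
    qed
    define B where "B = 2 * real (card C') + norm \<mu> + 2"
    have R: "norm (R t) \<le> B" for t
    proof -
      have "norm (1 / (\<rho> l * T t ^ Suc l) - \<rho> p / T t ^ Suc l) \<le> 2" for l
      proof -
        have "norm (T t ^ Suc l) \<ge> 1" using T(1) by (simp only: norm_power one_le_power)
        then have "1 / norm (T t ^ Suc l) \<le> 1" by (simp add: divide_le_eq)
        moreover have "norm (1 / (\<rho> l * T t ^ Suc l)) + norm (\<rho> p / T t ^ Suc l) = 2 * (1 / norm (T t ^ Suc l))"
          by (simp only: norm_divide norm_mult \<rho>) simp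
        ultimately show ?thesis
          using norm_triangle_ineq4[of "1 / (\<rho> l * T t ^ Suc l)" "\<rho> p / T t ^ Suc l"] by linarith
      qed
      then have "norm (\<Sum>l\<in>C'. 1 / (\<rho> l * T t ^ Suc l) - \<rho> p / T t ^ Suc l) \<le> (\<Sum>l\<in>C'. 2)"
        by (intro sum_norm_le)
      moreover have "norm (\<rho> p * \<mu>) = norm \<mu>" by (simp add: norm_mult \<rho>)
      moreover have "norm ((1 / \<rho> p - \<rho> p) / z t) \<le> 2"
      proof -
        have "norm (1 / \<rho> p - \<rho> p) \<le> 2"
          using norm_triangle_ineq4[of "1 / \<rho> p" "\<rho> p"] by (simp add: norm_divide \<rho>)
        then have "norm (1 / \<rho> p - \<rho> p) \<le> 2 * norm (z t)" using z(1)[of t] by linarith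
        then show ?thesis using z0 by (simp add: norm_divide divide_le_eq)
      qed
      ultimately show ?thesis
        unfolding R_def B_def by (intro order_trans[OF norm_triangle_ineq] add_mono) auto
    qed
    show "filterlim (\<lambda>t. kinetic C q c (y t)) at_infinity sequentially"
      unfolding filterlim_at_infinity[of 0, OF order_refl]
    proof (intro allI impI)
      fix r :: real
      have "\<exists>k. k \<noteq> 0 \<and> k \<le> Suc K \<and> a k \<noteq> 0"
        using h K by (intro exI[of _ "Suc h"]) (auto simp: a_def)
      then have "eventually (\<lambda>x. norm (P x) \<ge> r + B) at_infinity"
        unfolding P_def by (rule polyfun_extremal)
      moreover have "filterlim T at_infinity sequentially"
        unfolding T_def using filterlim_compose[OF tendsto_of_nat filterlim_Suc] .
      ultimately have "eventually (\<lambda>t. norm (P (T t)) \<ge> r + B) sequentially"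
        by (rule eventually_compose_filterlim)
      then show "eventually (\<lambda>t. r \<le> norm (kinetic C q c (y t))) sequentially"
      proof eventually_elim
        case (elim t)
        have "norm (P (T t)) \<le> norm (P (T t) + R t) + norm (R t)"
          using norm_triangle_ineq4[of "P (T t) + R t" "R t"] by simp
        then show ?case using elim R[of t] unfolding split by linarith
      qed
    qed
  qed
qed

section \<open>The Floquet determinant and the Laplacian in coordinates\<close>

lemma floquet_det_eq_det_on:
  assumes S: "finite S"
  shows "floquet_det S q V k z =
    det_on (fundamental_cell S q) (\<lambda>w w'. floquet_entry S q V k w w' - z * of_bool (w = w'))"
proof -
  define W where "W = fundamental_cell S q"
  define n where "n = card W"
  define f where "f w w' = floquet_entry S q V k w w' - z * of_bool (w = w')" for w w'
  have "finite W" unfolding W_def by (rule finite_fundamental_cell[OF S])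
  then have e: "bij_betw (from_nat_into W) {0..<n} W"
    unfolding n_def atLeast0LessThan by (rule bij_betw_from_nat_into_finite)
  have "floquet_matrix S q V k - z \<cdot>\<^sub>m 1\<^sub>m n =
      Matrix.mat n n (\<lambda>(a, b). f (from_nat_into W a) (from_nat_into W b))"
    unfolding floquet_matrix_def W_def[symmetric] n_def[symmetric] Let_def
    using e by (intro eq_matI) (auto simp: f_def bij_betw_def inj_on_def)
  then have "floquet_det S q V k z = det_on {0..<n} (\<lambda>a b. f (from_nat_into W a) (from_nat_into W b))"
    unfolding floquet_det_def W_def[symmetric] n_def[symmetric] by (simp add: det_mat_eq_det_on)
  also have "\<dots> = det_on W f" by (rule det_on_reindex[OF e]) simp
  finally show ?thesis unfolding W_def f_def .
qed

lemma discrete_laplacian_eq_sum: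
  assumes S: "finite S" and n: "n \<in> tuples S"
  shows "discrete_laplacian S u n = (\<Sum>l\<in>S. u (n(l := n l + 1)) + u (n(l := n l - 1)))"
proof -
  let ?g = "\<lambda>(l, s). n(l := n l + s)"
  have sphere: "{n' \<in> tuples S. l1_dist S n' n = 1} = ?g ` (S \<times> {1, -1})"
  proof (intro equalityI subsetI)
    fix n' assume "n' \<in> {n' \<in> tuples S. l1_dist S n' n = 1}"
    then have n': "n' \<in> tuples S" and d: "(\<Sum>l\<in>S. \<bar>n' l - n l\<bar>) = 1"
      by (auto simp: l1_dist_def)
    obtain l where l: "l \<in> S" "n' l \<noteq> n l"
    proof (rule ccontr)
      assume "\<not> thesis"
      then have "(\<Sum>l\<in>S. \<bar>n' l - n l\<bar>) = 0" using that by (intro sum.neutral) auto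
      with d show False by simp
    qed
    have "\<bar>n' l - n l\<bar> + (\<Sum>m\<in>S - {l}. \<bar>n' m - n m\<bar>) = 1"
      using d l S by (simp add: sum.remove)
    moreover have "(\<Sum>m\<in>S - {l}. \<bar>n' m - n m\<bar>) \<ge> 0" by (intro sum_nonneg) simp
    moreover have "\<bar>n' l - n l\<bar> \<ge> 1" using l by simp
    ultimately have one: "\<bar>n' l - n l\<bar> = 1" and "(\<Sum>m\<in>S - {l}. \<bar>n' m - n m\<bar>) = 0" by linarith+
    then have "\<forall>m\<in>S - {l}. \<bar>n' m - n m\<bar> = 0"
      using S by (subst (asm) sum_nonneg_eq_0_iff) auto
    then have "n' x = (n(l := n l + (n' l - n l))) x" for x
      using n n' by (cases "x \<in> S") (auto simp: PiE_iff extensional_def)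
    then have "n' = n(l := n l + (n' l - n l))" by blast
    moreover have "n' l - n l \<in> {1, -1}" using one by auto
    ultimately show "n' \<in> ?g ` (S \<times> {1, -1})" using l by (intro image_eqI[of _ _ "(l, n' l - n l)"]) auto
  next
    fix n' assume "n' \<in> ?g ` (S \<times> {1, -1})"
    then obtain x where x: "x \<in> S \<times> {1, -1}" "n' = ?g x" by (rule imageE)
    define l s where "l = fst x" and "s = snd x"
    have l: "l \<in> S" and s: "\<bar>s\<bar> = 1" and n': "n' = n(l := n l + s)"
      using x by (auto simp: l_def s_def)
    have "l1_dist S n' n = (\<Sum>m\<in>S. if m = l then 1 else 0)"
      unfolding l1_dist_def n' using s by (intro sum.cong) auto
    then show "n' \<in> {n' \<in> tuples S. l1_dist S n' n = 1}"
      using l n S unfolding n' by (auto simp: PiE_iff extensional_def)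
  qed
  have inj: "inj_on ?g (S \<times> {1, -1})"
  proof (rule inj_onI, clarify)
    fix l m s t assume s: "s \<in> {1, -1}" "t \<in> {1, -1::int}" and eq: "n(l := n l + s) = n(m := n m + t)"
    have "l = m" using fun_cong[OF eq, of l] s by (auto split: if_splits)
    then show "l = m \<and> s = t" using fun_cong[OF eq, of l] by simp
  qed
  have "discrete_laplacian S u n = (\<Sum>x\<in>S \<times> {1, -1}. u (?g x))"
    unfolding discrete_laplacian_def sphere by (subst sum.reindex[OF inj]) simp
  also have "\<dots> = (\<Sum>l\<in>S. \<Sum>s\<in>{1, -1}. u (n(l := n l + s)))"
    by (simp only: sum.cartesian_product')  (simp add: case_prod_beta)
  finally show ?thesis by simp
qed

text \<open>
  This allows the extension on \<open>T\<close> to be evaluated at points that carry further coordinates.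
\<close>

lemma floquet_extension_cong:
  assumes "\<And>l. l \<in> S \<Longrightarrow> n l = m l"
  shows "floquet_extension S q k f n = floquet_extension S q k f m"
proof -
  have "(\<lambda>j\<in>S. n j mod int (q j)) = (\<lambda>j\<in>S. m j mod int (q j))"
    using assms by (auto simp: fun_eq_iff)
  moreover have "(\<Sum>j\<in>S. k j * real_of_int (n j div int (q j))) = (\<Sum>j\<in>S. k j * real_of_int (m j div int (q j)))"
    using assms by (intro sum.cong) auto
  ultimately show ?thesis unfolding floquet_extension_def by simp
qed

section \<open>Plane waves on the period cell\<close>

lemma unit_root_add: "unit_root N (a + b) = unit_root N a * unit_root N b"
  unfolding unit_root_def by (simp add: add_divide_distrib distrib_left exp_add)

lemma unit_root_minus: "unit_root N (- a) = 1 / unit_root N a"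
  using unit_root_add[of N a "- a"] by (simp add: field_simps)

lemma unit_root_power: "unit_root N a ^ m = unit_root N (int m * a)"
  by (induction m) (simp_all add: unit_root_add algebra_simps)

lemma unit_root_power_int: "unit_root N a powi m = unit_root N (m * a)"
proof (cases "m \<ge> 0")
  case True
  then show ?thesis using unit_root_power[of N a "nat m"] by (simp add: power_int_def)
next
  case False
  then show ?thesis
    using unit_root_power[of N a "nat (- m)"] unit_root_minus[of N "- (m * a)"]
    by (simp add: power_int_def field_simps)
qed

lemma unit_root_period: "N > 0 \<Longrightarrow> unit_root N (int N * a) = 1"
  unfolding unit_root_def using exp_integer_2pi[of "of_int a"] by (simp add: field_simps)

lemma unit_root_eq_1_imp_dvd:
  assumes N: "N > 0" and eq: "unit_root N a = 1"
  shows "int N dvd a"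
proof -
  obtain m :: int where m: "Im (2 * pi * \<i> * complex_of_real (real_of_int a / real N)) = of_int (2 * m) * pi"
    using eq unfolding unit_root_def exp_eq_1 by blast
  have "real_of_int a = real_of_int (m * int N)" using m N by (simp add: field_simps)
  then have "a = m * int N" by (simp only: of_int_eq_iff)
  then show ?thesis by simp
qed

lemma sum_unit_root:
  assumes N: "N > 0" and a: "\<bar>a\<bar> < int N"
  shows "(\<Sum>x\<in>{0..int N - 1}. unit_root N (x * a)) = of_nat N * of_bool (a = 0)"
proof -
  have "(\<Sum>x\<in>{0..int N - 1}. unit_root N (x * a)) = (\<Sum>m<N. unit_root N a ^ m)"
    by (rule sum.reindex_bij_witness[of _ int nat]) (auto simp: unit_root_power)
  also have "\<dots> = of_nat N * of_bool (a = 0)"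
  proof (cases "a = 0")
    case False
    then have "unit_root N a \<noteq> 1"
      using unit_root_eq_1_imp_dvd[OF N, of a] a by (auto dest: zdvd_not_zless dvd_imp_le_int)
    moreover have "unit_root N a ^ N = 1" using unit_root_period[OF N] by (simp add: unit_root_power)
    ultimately show ?thesis using False by (simp add: sum_gp_strict)
  qed simp
  finally show ?thesis .
qed

text \<open>
  The quotient of the plane waves of frequencies \<open>c\<close> and \<open>c'\<close>; it does not depend on the
  quasimomentum (\<open>wave_divide_wave\<close>).
\<close>

definition character :: "nat set \<Rightarrow> (nat \<Rightarrow> nat) \<Rightarrow> (nat \<Rightarrow> int) \<Rightarrow> (nat \<Rightarrow> int) \<Rightarrow> (nat \<Rightarrow> int) \<Rightarrow> complex" where
  "character C q c c' x = (\<Prod>l\<in>C. unit_root (q l) (x l * (c l - c' l)))"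

text \<open>
  Orthogonality of characters: the sum factors over the coordinates into geometric sums.
\<close>

lemma sum_character:
  assumes C: "finite C" and q: "\<And>l. l \<in> C \<Longrightarrow> q l > 0"
    and c: "c \<in> fundamental_cell C q" "c' \<in> fundamental_cell C q"
  shows "(\<Sum>x\<in>fundamental_cell C q. character C q c c' x) =
    of_nat (card (fundamental_cell C q)) * of_bool (c = c')"
proof -
  have range: "0 \<le> c l" "c l < int (q l)" "0 \<le> c' l" "c' l < int (q l)" if "l \<in> C" for l
    using c that unfolding fundamental_cell_def by auto
  have "(\<Sum>x\<in>fundamental_cell C q. character C q c c' x) =
      (\<Prod>l\<in>C. \<Sum>x\<in>{0..int (q l) - 1}. unit_root (q l) (x * (c l - c' l)))"
    unfolding character_def fundamental_cell_PiE by (rule prod_sum_PiE[symmetric]) (use C in auto)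
  also have "\<dots> = (\<Prod>l\<in>C. of_nat (q l) * of_bool (c l = c' l))"
  proof (rule prod.cong[OF refl])
    fix l assume l: "l \<in> C"
    have "\<bar>c l - c' l\<bar> < int (q l)" using range[OF l] by linarith
    then show "(\<Sum>x\<in>{0..int (q l) - 1}. unit_root (q l) (x * (c l - c' l))) = of_nat (q l) * of_bool (c l = c' l)"
      using sum_unit_root[OF q[OF l], of "c l - c' l"] by simp
  qed
  also have "\<dots> = of_nat (card (fundamental_cell C q)) * (\<Prod>l\<in>C. of_bool (c l = c' l))"
    using C by (simp add: card_fundamental_cell prod.distrib)
  also have "(\<Prod>l\<in>C. of_bool (c l = c' l)) = (of_bool (c = c') :: complex)"
  proof (cases "c = c'")
    case False
    then obtain l where "l \<in> C" "c l \<noteq> c' l"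
      using c by (auto simp: fundamental_cell_def fun_eq_iff PiE_iff extensional_def) metis
    then show ?thesis using False C by auto
  qed simp
  finally show ?thesis .
qed

text \<open>
  The plane waves that satisfy the Floquet condition in the \<open>C\<close>-directions when
  \<open>y l ^ q l = exp(2\<pi>ik\<^sub>l)\<close>.  They are parametrised by \<open>y\<close> and not by the quasimomentum \<open>k\<close>, as it is \<open>y\<close>
  that leaves the torus.
\<close>

definition wave ::
  "nat set \<Rightarrow> (nat \<Rightarrow> nat) \<Rightarrow> (nat \<Rightarrow> complex) \<Rightarrow> (nat \<Rightarrow> int) \<Rightarrow> (nat \<Rightarrow> int) \<Rightarrow> complex" where
  "wave C q y c x = (\<Prod>l\<in>C. (unit_root (q l) (c l) * y l) powi x l)"

lemma wave_cong: "(\<And>l. l \<in> C \<Longrightarrow> x l = x' l) \<Longrightarrow> wave C q y c x = wave C q y c x'"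
  unfolding wave_def by (intro prod.cong) auto

lemma wave_shift:
  assumes C: "finite C" and l: "l \<in> C" and y: "y l \<noteq> 0"
  shows "wave C q y c (x(l := x l + s)) = (unit_root (q l) (c l) * y l) powi s * wave C q y c x"
proof -
  have "(\<Prod>m\<in>C - {l}. (unit_root (q m) (c m) * y m) powi (x(l := x l + s)) m) =
      (\<Prod>m\<in>C - {l}. (unit_root (q m) (c m) * y m) powi x m)"
    by (intro prod.cong) auto
  then show ?thesis
    unfolding wave_def prod.remove[OF C l] using y by (simp add: power_int_add)
qed

lemma wave_divide_wave:
  assumes y: "\<And>l. l \<in> C \<Longrightarrow> y l \<noteq> 0"
  shows "wave C q y c x / wave C q y c' x = character C q c c' x"
  unfolding wave_def character_def prod_dividef[symmetric]
proof (rule prod.cong[OF refl])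
  fix l assume l: "l \<in> C"
  have "(unit_root (q l) (c l) * y l) powi x l / (unit_root (q l) (c' l) * y l) powi x l =
      unit_root (q l) (x l * c l) / unit_root (q l) (x l * c' l)"
    using y[OF l] by (simp add: power_int_mult_distrib unit_root_power_int)
  also have "\<dots> = unit_root (q l) (x l * (c l - c' l))"
    using unit_root_add[of "q l" "x l * c l" "- (x l * c' l)"] by (simp add: unit_root_minus algebra_simps)
  finally show "(unit_root (q l) (c l) * y l) powi x l / (unit_root (q l) (c' l) * y l) powi x l =
      unit_root (q l) (x l * (c l - c' l))" .
qed

section \<open>The Fourier transform in part of the coordinates\<close>

definition join :: "nat set \<Rightarrow> (nat \<Rightarrow> int) \<Rightarrow> (nat \<Rightarrow> int) \<Rightarrow> nat \<Rightarrow> int" where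
  "join T a c = (\<lambda>l. if l \<in> T then a l else c l)"

definition fourier_coeff ::
  "nat set \<Rightarrow> nat set \<Rightarrow> (nat \<Rightarrow> nat) \<Rightarrow> ((nat \<Rightarrow> int) \<Rightarrow> complex) \<Rightarrow>
   (nat \<Rightarrow> int) \<Rightarrow> (nat \<Rightarrow> int) \<Rightarrow> (nat \<Rightarrow> int) \<Rightarrow> complex" where
  "fourier_coeff T C q V a c' c =
     (\<Sum>x\<in>fundamental_cell C q. V (join T a x) * character C q c c' x) / of_nat (card (fundamental_cell C q))"

text \<open>
  The Floquet matrix minus \<open>z\<close> in the basis consisting of unit vectors in the \<open>T\<close>-directions times
  plane waves in the \<open>C\<close>-directions.  Taking the Floquet entry of the potential \<open>0\<close> leaves just the
  Laplacian in the \<open>T\<close>-directions.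
\<close>

definition mixed_entry ::
  "nat set \<Rightarrow> nat set \<Rightarrow> (nat \<Rightarrow> nat) \<Rightarrow> ((nat \<Rightarrow> int) \<Rightarrow> complex) \<Rightarrow> (nat \<Rightarrow> real) \<Rightarrow> complex \<Rightarrow>
   (nat \<Rightarrow> complex) \<Rightarrow> (nat \<Rightarrow> int) \<times> (nat \<Rightarrow> int) \<Rightarrow> (nat \<Rightarrow> int) \<times> (nat \<Rightarrow> int) \<Rightarrow> complex" where
  "mixed_entry T C q V k z y v w =
     of_bool (snd v = snd w) *
       (floquet_entry T q (\<lambda>_. 0) k (fst v) (fst w) + of_bool (fst v = fst w) * (kinetic C q (snd w) y - z))
     + of_bool (fst v = fst w) * fourier_coeff T C q V (fst v) (snd v) (snd w)"

locale split_lattice =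
  fixes T C :: "nat set" and q :: "nat \<Rightarrow> nat"
  assumes finT: "finite T" and finC: "finite C" and disj: "T \<inter> C = {}"
    and pos: "\<And>l. l \<in> T \<union> C \<Longrightarrow> q l > 0"
begin

lemma fin: "finite (T \<union> C)"
  using finT finC by simp

lemma join_T [simp]: "l \<in> T \<Longrightarrow> join T a c l = a l"
  by (simp add: join_def)

lemma join_C [simp]: "l \<in> C \<Longrightarrow> join T a c l = c l"
  using disj by (auto simp: join_def)

lemma join_tuples: "c \<in> tuples C \<Longrightarrow> join T a c \<in> tuples (T \<union> C)"
  by (auto simp: join_def PiE_iff extensional_def)

lemma bij_join:
  "bij_betw (\<lambda>(a, c). join T a c) (fundamental_cell T q \<times> fundamental_cell C q) (fundamental_cell (T \<union> C) q)"
proof (rule bij_betw_byWitness[where f' = "\<lambda>n. (restrict n T, restrict n C)"])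
  show "\<forall>x\<in>fundamental_cell T q \<times> fundamental_cell C q.
      (restrict (case x of (a, c) \<Rightarrow> join T a c) T, restrict (case x of (a, c) \<Rightarrow> join T a c) C) = x"
    using disj by (auto simp: fundamental_cell_def join_def fun_eq_iff PiE_iff extensional_def)
  show "\<forall>n\<in>fundamental_cell (T \<union> C) q. (case (restrict n T, restrict n C) of (a, c) \<Rightarrow> join T a c) = n"
    using disj by (auto simp: fundamental_cell_def join_def fun_eq_iff PiE_iff extensional_def)
  show "(\<lambda>(a, c). join T a c) ` (fundamental_cell T q \<times> fundamental_cell C q) \<subseteq> fundamental_cell (T \<union> C) q"
    by (auto simp: fundamental_cell_def join_def PiE_iff extensional_def)
  show "(\<lambda>n. (restrict n T, restrict n C)) ` fundamental_cell (T \<union> C) q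
      \<subseteq> fundamental_cell T q \<times> fundamental_cell C q"
    by (auto simp: fundamental_cell_def)
qed

text \<open>
  The mixed basis vectors, as elements of the Floquet space of \<open>T \<union> C\<close>.
\<close>

definition mixed_wave :: "(nat \<Rightarrow> real) \<Rightarrow> (nat \<Rightarrow> complex) \<Rightarrow> (nat \<Rightarrow> int) \<Rightarrow> (nat \<Rightarrow> int) \<Rightarrow> (nat \<Rightarrow> int) \<Rightarrow> complex" where
  "mixed_wave k y a c x = floquet_extension T q k (\<lambda>n. if n = a then 1 else 0) x * wave C q y c x"

context
  fixes k :: "nat \<Rightarrow> real" and y :: "nat \<Rightarrow> complex"
  assumes y: "\<And>l. l \<in> C \<Longrightarrow> y l ^ q l = exp (2 * pi * \<i> * complex_of_real (k l))"
begin

lemma y_nonzero: "l \<in> C \<Longrightarrow> y l \<noteq> 0"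
  using y[of l] pos[of l] by (auto simp: power_0_left)

lemma mixed_wave_in_floquet_space: "mixed_wave k y a c \<in> floquet_space (T \<union> C) q k"
  unfolding floquet_space_def
proof (intro CollectI ballI)
  fix n :: "nat \<Rightarrow> int" and j assume n: "n \<in> tuples (T \<union> C)" and j: "j \<in> T \<union> C"
  let ?n = "n(j := n j + int (q j))" and ?\<delta> = "\<lambda>n. if n = a then 1 else 0 :: complex"
  show "mixed_wave k y a c ?n = exp (2 * pi * \<i> * complex_of_real (k j)) * mixed_wave k y a c n"
  proof (cases "j \<in> T")
    case True
    then have jC: "j \<notin> C" using disj by auto
    let ?m = "restrict n T"
    have "floquet_extension T q k ?\<delta> \<in> floquet_space T q k"
      by (rule floquet_extension_in) (use finT pos in auto)
    moreover have "?m \<in> tuples T" by auto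
    ultimately have "floquet_extension T q k ?\<delta> (?m(j := ?m j + int (q j))) =
        exp (2 * pi * \<i> * complex_of_real (k j)) * floquet_extension T q k ?\<delta> ?m"
      using True unfolding floquet_space_def by blast
    moreover have "floquet_extension T q k ?\<delta> (?m(j := ?m j + int (q j))) = floquet_extension T q k ?\<delta> ?n"
      by (rule floquet_extension_cong) (use True in auto)
    moreover have "floquet_extension T q k ?\<delta> ?m = floquet_extension T q k ?\<delta> n"
      by (rule floquet_extension_cong) auto
    moreover have "wave C q y c ?n = wave C q y c n"
      by (rule wave_cong) (use jC in auto)
    ultimately show ?thesis by (simp add: mixed_wave_def)
  next
    case False
    then have jC: "j \<in> C" using j by auto
    have "floquet_extension T q k ?\<delta> ?n = floquet_extension T q k ?\<delta> n"
      by (rule floquet_extension_cong) (use False in auto)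
    moreover have "(unit_root (q j) (c j) * y j) powi int (q j) = exp (2 * pi * \<i> * complex_of_real (k j))"
      using pos[OF j] by (simp add: power_mult_distrib y[OF jC] unit_root_power unit_root_period)
    then have "wave C q y c ?n = exp (2 * pi * \<i> * complex_of_real (k j)) * wave C q y c n"
      by (simp only: wave_shift[where y = y, OF finC jC y_nonzero[OF jC]])
    ultimately show ?thesis by (simp add: mixed_wave_def)
  qed
qed

lemma mixed_wave_join:
  assumes "a' \<in> fundamental_cell T q"
  shows "mixed_wave k y a c (join T a' c') = of_bool (a' = a) * wave C q y c c'"
proof -
  let ?\<delta> = "\<lambda>n. if n = a then 1 else 0 :: complex"
  have "floquet_extension T q k ?\<delta> (join T a' c') = floquet_extension T q k ?\<delta> a'"
    by (rule floquet_extension_cong) simp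
  also have "\<dots> = of_bool (a' = a)" by (simp add: floquet_extension_cell[OF assms])
  moreover have "wave C q y c (join T a' c') = wave C q y c c'"
    by (rule wave_cong) simp
  ultimately show ?thesis by (simp add: mixed_wave_def)
qed

lemma schroedinger_mixed_wave:
  assumes a': "a' \<in> fundamental_cell T q" and c': "c' \<in> fundamental_cell C q"
  shows "schroedinger (T \<union> C) V (mixed_wave k y a c) (join T a' c') =
    (floquet_entry T q (\<lambda>_. 0) k a' a + of_bool (a' = a) * (kinetic C q c y + V (join T a' c'))) * wave C q y c c'"
proof -
  let ?x = "join T a' c'" and ?\<delta> = "\<lambda>n. if n = a then 1 else 0 :: complex"
  let ?u = "mixed_wave k y a c"
  have tup: "a' \<in> tuples T" "?x \<in> tuples (T \<union> C)"
    using a' c' by (auto simp: fundamental_cell_def intro!: join_tuples)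
  have 1: "?u (?x(l := ?x l + s)) = floquet_extension T q k ?\<delta> (a'(l := a' l + s)) * wave C q y c c'"
    if l: "l \<in> T" for l s
  proof -
    have "l \<notin> C" using l disj by auto
    then have "floquet_extension T q k ?\<delta> (?x(l := ?x l + s)) = floquet_extension T q k ?\<delta> (a'(l := a' l + s))"
      "wave C q y c (?x(l := ?x l + s)) = wave C q y c c'"
      using l by (auto intro!: floquet_extension_cong wave_cong)
    then show ?thesis by (simp add: mixed_wave_def)
  qed
  have 2: "?u (?x(l := ?x l + s)) = (unit_root (q l) (c l) * y l) powi s * (of_bool (a' = a) * wave C q y c c')"
    if l: "l \<in> C" for l s
  proof -
    have "l \<notin> T" using l disj by auto
    then have "floquet_extension T q k ?\<delta> (?x(l := ?x l + s)) = floquet_extension T q k ?\<delta> ?x"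
      by (intro floquet_extension_cong) auto
    then have "?u (?x(l := ?x l + s)) = (unit_root (q l) (c l) * y l) powi s * ?u ?x"
      by (simp only: mixed_wave_def wave_shift[where y = y, OF finC l y_nonzero[OF l]] mult.left_commute)
    then show ?thesis by (simp only: mixed_wave_join[OF a'])
  qed
  have "discrete_laplacian (T \<union> C) ?u ?x =
      (\<Sum>l\<in>T. ?u (?x(l := ?x l + 1)) + ?u (?x(l := ?x l - 1))) +
      (\<Sum>l\<in>C. ?u (?x(l := ?x l + 1)) + ?u (?x(l := ?x l - 1)))"
    unfolding discrete_laplacian_eq_sum[OF fin tup(2)] by (rule sum.union_disjoint[OF finT finC disj])
  also have "(\<Sum>l\<in>T. ?u (?x(l := ?x l + 1)) + ?u (?x(l := ?x l - 1))) =
      discrete_laplacian T (floquet_extension T q k ?\<delta>) a' * wave C q y c c'"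
    unfolding discrete_laplacian_eq_sum[OF finT tup(1)] sum_distrib_right
    using 1[of _ 1] 1[of _ "-1"] by (intro sum.cong refl) (simp add: distrib_right)
  also have "(\<Sum>l\<in>C. ?u (?x(l := ?x l + 1)) + ?u (?x(l := ?x l - 1))) =
      kinetic C q c y * (of_bool (a' = a) * wave C q y c c')"
    unfolding kinetic_def sum_distrib_right
    using 2[of _ 1] 2[of _ "-1"]
    by (intro sum.cong refl) (simp add: distrib_right power_int_minus inverse_eq_divide)
  finally show ?thesis
    by (simp add: schroedinger_def floquet_entry_def mixed_wave_join[OF a'] algebra_simps)
qed

text \<open>
  With \<open>F\<close> the matrix of the mixed basis and \<open>D\<close> the Floquet matrix minus \<open>z\<close>, the columns of \<open>D F\<close> are
  the images of the mixed waves under the operator, which are known from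
  \<open>schroedinger_mixed_wave\<close>.  The inverse \<open>G\<close> of \<open>F\<close> comes from the orthogonality of characters, and
  \<open>G D F\<close> turns multiplication by \<open>V\<close> into its Fourier coefficients.
\<close>

lemma floquet_det_eq_mixed:
  "floquet_det (T \<union> C) q V k z =
    det_on (fundamental_cell T q \<times> fundamental_cell C q) (mixed_entry T C q V k z y)"
proof -
  define A where "A = fundamental_cell T q"
  define B where "B = fundamental_cell C q"
  have finA: "finite A" and finB: "finite B"
    unfolding A_def B_def by (simp_all add: finite_fundamental_cell finT finC)
  define Q where "Q = (of_nat (card B) :: complex)"
  have Q: "Q \<noteq> 0" unfolding Q_def B_def using finC pos by (simp add: card_fundamental_cell)
  define J where "J = (\<lambda>(a, c). join T a c)"
  have J: "bij_betw J (A \<times> B) (fundamental_cell (T \<union> C) q)"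
    unfolding J_def A_def B_def by (rule bij_join)
  define w where "w = wave C q y"
  have chi: "w c' x / w c x = character C q c' c x" for c c' x
    unfolding w_def by (rule wave_divide_wave[OF y_nonzero])
  define D where "D p p' = floquet_entry (T \<union> C) q V k (J p) (J p') - z * of_bool (p = p')" for p p'
  define F where "F p p' = mixed_wave k y (fst p') (snd p') (J p)" for p p'
  define G where "G p p' = of_bool (fst p = fst p') / (Q * w (snd p) (snd p'))" for p p' :: "(nat \<Rightarrow> int) \<times> (nat \<Rightarrow> int)"
  have F: "F (a', c') (a, c) = of_bool (a' = a) * w c c'" if "a' \<in> A" for a' c' a c
    using mixed_wave_join[of a' a c c'] that unfolding F_def J_def w_def A_def by simp
  have G_sum: "(\<Sum>x\<in>A \<times> B. G (a, c) x * h x) = (\<Sum>x\<in>B. h (a, x) / w c x) / Q" if a: "a \<in> A" for a c h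
  proof -
    have "(\<Sum>x\<in>A \<times> B. G (a, c) x * h x) = (\<Sum>a'\<in>A. if a = a' then (\<Sum>x\<in>B. h (a', x) / (Q * w c x)) else 0)"
      unfolding sum.cartesian_product' G_def by (intro sum.cong refl) simp
    also have "\<dots> = (\<Sum>x\<in>B. h (a, x) / (Q * w c x))" using a finA by simp
    finally show ?thesis by (simp add: sum_divide_distrib mult.commute)
  qed
  have inv: "(\<Sum>x\<in>A \<times> B. G p x * F x p') = of_bool (p = p')" if p: "p \<in> A \<times> B" "p' \<in> A \<times> B" for p p'
  proof -
    obtain a c a' c' where pp: "p = (a, c)" "p' = (a', c')" by (cases p, cases p')
    have mem: "a \<in> A" "c \<in> B" "c' \<in> B" using p pp by auto
    have "(\<Sum>x\<in>A \<times> B. G p x * F x p') = of_bool (a = a') * (\<Sum>x\<in>B. w c' x / w c x) / Q"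
      unfolding pp G_sum[OF mem(1)] by (simp add: F[OF mem(1)])
    also have "(\<Sum>x\<in>B. w c' x / w c x) = Q * of_bool (c' = c)"
      unfolding chi
      using sum_character[of C q c' c] finC pos mem unfolding B_def Q_def by simp
    finally show ?thesis using Q by (auto simp: pp)
  qed
  have DF: "(\<Sum>x\<in>A \<times> B. D (a', c') x * F x (a, c)) =
      (floquet_entry T q (\<lambda>_. 0) k a' a + of_bool (a' = a) * (kinetic C q c y - z)
        + of_bool (a' = a) * V (join T a' c')) * w c c'"
    if mem: "a' \<in> A" "c' \<in> B" for a' c' a c
  proof -
    have cell: "J (a', c') \<in> fundamental_cell (T \<union> C) q"
      using J mem by (auto simp: bij_betw_def)
    have "(\<Sum>x\<in>A \<times> B. D (a', c') x * F x (a, c)) =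
        (\<Sum>x\<in>A \<times> B. floquet_entry (T \<union> C) q V k (J (a', c')) (J x) * mixed_wave k y a c (J x))
        - z * (\<Sum>x\<in>A \<times> B. if (a', c') = x then F x (a, c) else 0)"
      unfolding D_def left_diff_distrib sum_subtractf sum_distrib_left
      by (intro arg_cong2[of _ _ _ _ "(-)"] sum.cong refl) (auto simp: F_def)
    also have "(\<Sum>x\<in>A \<times> B. if (a', c') = x then F x (a, c) else 0) = F (a', c') (a, c)"
      using mem finA finB by simp
    also have "(\<Sum>x\<in>A \<times> B. floquet_entry (T \<union> C) q V k (J (a', c')) (J x) * mixed_wave k y a c (J x)) =
        schroedinger (T \<union> C) V (mixed_wave k y a c) (J (a', c'))"
      using sum.reindex_bij_betw[OF J, of "\<lambda>x. floquet_entry (T \<union> C) q V k (J (a', c')) x * mixed_wave k y a c x"]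
        schroedinger_eq_floquet_entry[OF fin pos mixed_wave_in_floquet_space cell] by simp
    also have "\<dots> = (floquet_entry T q (\<lambda>_. 0) k a' a + of_bool (a' = a) * (kinetic C q c y + V (join T a' c'))) * w c c'"
      using schroedinger_mixed_wave[of a' c' V a c] mem unfolding A_def B_def J_def w_def by simp
    finally show ?thesis by (simp add: F[OF mem(1)] algebra_simps)
  qed
  have GDF: "(\<Sum>x\<in>A \<times> B. G p x * (\<Sum>x'\<in>A \<times> B. D x x' * F x' p')) = mixed_entry T C q V k z y p p'"
    if p: "p \<in> A \<times> B" "p' \<in> A \<times> B" for p p'
  proof -
    obtain a c a' c' where pp: "p = (a, c)" "p' = (a', c')" by (cases p, cases p')
    have mem: "a \<in> A" "c \<in> B" "c' \<in> B" using p pp by auto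
    define e where "e = floquet_entry T q (\<lambda>_. 0) k a a' + of_bool (a = a') * (kinetic C q c' y - z)"
    have "(\<Sum>x\<in>A \<times> B. G p x * (\<Sum>x'\<in>A \<times> B. D x x' * F x' p')) =
        (\<Sum>x\<in>B. (e + of_bool (a = a') * V (join T a x)) * (w c' x / w c x)) / Q"
      unfolding pp G_sum[OF mem(1)] e_def
      by (intro arg_cong2[of _ _ _ _ "(/)"] sum.cong refl) (simp only: DF[OF mem(1)] times_divide_eq_right)
    also have "\<dots> = (e * (\<Sum>x\<in>B. character C q c' c x) +
        of_bool (a = a') * (\<Sum>x\<in>B. V (join T a x) * character C q c' c x)) / Q"
      unfolding chi by (simp add: distrib_right sum.distrib sum_distrib_left mult.assoc)
    also have "(\<Sum>x\<in>B. character C q c' c x) = Q * of_bool (c' = c)"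
      using sum_character[of C q c' c] finC pos mem unfolding B_def Q_def by simp
    finally show ?thesis
      using Q unfolding pp mixed_entry_def fourier_coeff_def B_def[symmetric] Q_def[symmetric] e_def
      by (auto simp: add_divide_distrib)
  qed
  have "floquet_det (T \<union> C) q V k z = det_on (A \<times> B) D"
  proof -
    have "det_on (A \<times> B) D =
        det_on (A \<times> B) (\<lambda>p p'. floquet_entry (T \<union> C) q V k (J p) (J p') - z * of_bool (J p = J p'))"
      by (rule det_on_cong) (use J in \<open>auto simp: D_def bij_betw_def dest: inj_onD\<close>)
    also have "\<dots> = floquet_det (T \<union> C) q V k z"
      unfolding floquet_det_eq_det_on[OF fin] by (rule det_on_reindex[OF J]) (use finA finB in simp)
    finally show ?thesis ..
  qed
  also have "\<dots> = det_on (A \<times> B) (\<lambda>p p'. \<Sum>x\<in>A \<times> B. G p x * (\<Sum>x'\<in>A \<times> B. D x x' * F x' p'))"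
    by (rule det_on_similar[symmetric]) (use finA finB inv in auto)
  also have "\<dots> = det_on (A \<times> B) (mixed_entry T C q V k z y)"
    by (rule det_on_cong) (rule GDF)
  finally show ?thesis unfolding A_def B_def .
qed

end

end

section \<open>Averaging over part of the coordinates\<close>

lemma floquet_extension_cong_quasimomentum:
  assumes "\<And>l. l \<in> S \<Longrightarrow> k l = k' l"
  shows "floquet_extension S q k f = floquet_extension S q k' f"
proof
  fix n
  have "(\<Sum>j\<in>S. k j * real_of_int (n j div int (q j))) = (\<Sum>j\<in>S. k' j * real_of_int (n j div int (q j)))"
    using assms by (intro sum.cong) auto
  then show "floquet_extension S q k f n = floquet_extension S q k' f n"
    unfolding floquet_extension_def by simp
qed

lemma floquet_entry_potential:
  assumes "w \<in> fundamental_cell S q"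
  shows "floquet_entry S q V k w w' = floquet_entry S q (\<lambda>_. 0) k w w' + V w * of_bool (w = w')"
  by (simp add: floquet_entry_def schroedinger_def floquet_extension_cell[OF assms])

lemma floquet_det_cong_potential:
  assumes S: "finite S" and VV: "\<And>n. n \<in> tuples S \<Longrightarrow> V n = V' n"
  shows "floquet_det S q V k z = floquet_det S q V' k z"
  unfolding floquet_det_eq_det_on[OF S]
proof (rule det_on_cong)
  fix w w' assume w: "w \<in> fundamental_cell S q"
  then have "V w = V' w" using VV by (simp add: fundamental_cell_def)
  then show "floquet_entry S q V k w w' - z * of_bool (w = w') = floquet_entry S q V' k w w' - z * of_bool (w = w')"
    by (simp add: floquet_entry_def schroedinger_def)
qed

lemma lattice_periodic_cong:
  assumes VV: "\<And>n. n \<in> tuples S \<Longrightarrow> V n = V' n" and V: "lattice_periodic S q V"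
  shows "lattice_periodic S q V'"
  unfolding lattice_periodic_def
proof (intro ballI)
  fix n g :: "nat \<Rightarrow> int" assume n: "n \<in> tuples S" and g: "g \<in> period_lattice S q"
  have "V (\<lambda>l\<in>S. n l + g l) = V n" using V n g unfolding lattice_periodic_def by blast
  then show "V' (\<lambda>l\<in>S. n l + g l) = V' n" using VV n by simp
qed

definition cell_mean ::
  "nat set \<Rightarrow> nat set \<Rightarrow> (nat \<Rightarrow> nat) \<Rightarrow> ((nat \<Rightarrow> int) \<Rightarrow> complex) \<Rightarrow> (nat \<Rightarrow> int) \<Rightarrow> complex" where
  "cell_mean T C q V n =
     (\<Sum>x\<in>fundamental_cell C q. V (join T n x)) / of_nat (card (fundamental_cell C q))"

lemma fourier_coeff_diagonal: "fourier_coeff T C q V a c c = cell_mean T C q V a"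
  by (simp add: fourier_coeff_def cell_mean_def character_def)

text \<open>
  Only the diagonal depends on \<open>y\<close>, and only through the kinetic energy.
\<close>

lemma mixed_entry_split:
  "mixed_entry T C q V k z y v w = of_bool (v = w) * kinetic C q (snd v) y +
     (of_bool (snd v = snd w) * (floquet_entry T q (\<lambda>_. 0) k (fst v) (fst w) - of_bool (fst v = fst w) * z)
      + of_bool (fst v = fst w) * fourier_coeff T C q V (fst v) (snd v) (snd w))"
  unfolding mixed_entry_def by (auto simp: prod_eq_iff)

lemma (in split_lattice) lattice_periodic_cell_mean:
  assumes V: "lattice_periodic (T \<union> C) q V"
  shows "lattice_periodic T q (\<lambda>n. cell_mean T C q V n + z)"
  unfolding lattice_periodic_def
proof (intro ballI)
  fix n g :: "nat \<Rightarrow> int" assume n: "n \<in> tuples T" and g: "g \<in> period_lattice T q"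
  have "V (join T (\<lambda>l\<in>T. n l + g l) x) = V (join T n x)" if x: "x \<in> fundamental_cell C q" for x
  proof -
    let ?g = "\<lambda>l\<in>T \<union> C. if l \<in> T then g l else 0"
    have x': "x \<in> tuples C" using x by (simp add: fundamental_cell_def)
    have "?g \<in> period_lattice (T \<union> C) q" using g by (auto simp: period_lattice_def)
    moreover have "join T n x \<in> tuples (T \<union> C)" by (rule join_tuples[OF x'])
    ultimately have "V (\<lambda>l\<in>T \<union> C. join T n x l + ?g l) = V (join T n x)"
      using V unfolding lattice_periodic_def by blast
    moreover have "(\<lambda>l\<in>T \<union> C. join T n x l + ?g l) = join T (\<lambda>l\<in>T. n l + g l) x"
      using x' by (auto simp: join_def fun_eq_iff PiE_iff extensional_def)
    ultimately show ?thesis by simp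
  qed
  then show "cell_mean T C q V (\<lambda>l\<in>T. n l + g l) + z = cell_mean T C q V n + z"
    by (simp add: cell_mean_def)
qed

context split_lattice
begin

abbreviation mixed_det :: "((nat \<Rightarrow> int) \<Rightarrow> complex) \<Rightarrow> (nat \<Rightarrow> real) \<Rightarrow> complex \<Rightarrow> (nat \<Rightarrow> complex) \<Rightarrow> complex" where
  "mixed_det V k z y \<equiv> det_on (fundamental_cell T q \<times> fundamental_cell C q) (mixed_entry T C q V k z y)"

lemma holomorphic_kinetic:
  assumes l: "l \<in> C" and y: "\<forall>m\<in>C. y m \<noteq> 0"
  shows "(\<lambda>t. kinetic C q c (y(l := t))) holomorphic_on - {0}"
  unfolding kinetic_def
proof (intro holomorphic_on_sum)
  fix m assume m: "m \<in> C"
  show "(\<lambda>t. unit_root (q m) (c m) * (y(l := t)) m + 1 / (unit_root (q m) (c m) * (y(l := t)) m))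
      holomorphic_on - {0}"
    using y m by (cases "m = l") (auto intro!: holomorphic_intros)
qed

text \<open>
  The point \<open>y\<close> of the torus belongs to the real quasimomentum \<open>q\<^sub>l arg(y\<^sub>l) / (2\<pi>)\<close> in the directions
  \<open>l \<in> C\<close>, so there the identity is the hypothesis.  The quasimomentum in the \<open>T\<close>-directions stays
  fixed.
\<close>

lemma mixed_det_eq_of_fermi:
  assumes fermi: "generalized_fermi_isospectral (T \<union> C) q V z\<^sub>1 Y z\<^sub>2"
    and y: "\<forall>l\<in>C. y l \<noteq> 0"
  shows "mixed_det V k z\<^sub>1 y = mixed_det Y k z\<^sub>2 y"
proof -
  have "mixed_det V k z\<^sub>1 y - mixed_det Y k z\<^sub>2 y = 0"
  proof (rule zero_on_torus_imp_zero[where C = C and g = "\<lambda>y. mixed_det V k z\<^sub>1 y - mixed_det Y k z\<^sub>2 y"])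
    show "finite C" by (rule finC)
    show "\<forall>l\<in>C. y l \<noteq> 0" by (rule y)
  next
    fix y :: "nat \<Rightarrow> complex" and l assume "l \<in> C" "\<forall>m\<in>C. y m \<noteq> 0"
    then show "(\<lambda>t. mixed_det V k z\<^sub>1 (y(l := t)) - mixed_det Y k z\<^sub>2 (y(l := t))) holomorphic_on - {0}"
      unfolding mixed_entry_split
      by (intro holomorphic_on_diff holomorphic_det_on holomorphic_on_add holomorphic_on_mult
          holomorphic_on_const holomorphic_kinetic)
  next
    fix y :: "nat \<Rightarrow> complex" assume y: "\<forall>l\<in>C. norm (y l) = 1"
    define k' where "k' = (\<lambda>l\<in>T \<union> C. if l \<in> T then k l else real (q l) * Arg2pi (y l) / (2 * pi))"
    have "y l ^ q l = exp (2 * pi * \<i> * complex_of_real (k' l))" if l: "l \<in> C" for l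
    proof -
      have "l \<notin> T" using l disj by auto
      have "y l ^ q l = exp (\<i> * of_real (Arg2pi (y l))) ^ q l"
        using y l complex_norm_eq_1_exp by metis
      also have "\<dots> = exp (of_nat (q l) * (\<i> * of_real (Arg2pi (y l))))"
        by (rule exp_of_nat_mult[symmetric])
      also have "of_nat (q l) * (\<i> * of_real (Arg2pi (y l))) = 2 * pi * \<i> * complex_of_real (k' l)"
        using l \<open>l \<notin> T\<close> by (simp add: k'_def)
      finally show ?thesis .
    qed
    then have det: "floquet_det (T \<union> C) q U k' z = mixed_det U k' z y" for U z
      by (rule floquet_det_eq_mixed)
    have "floquet_entry T q (\<lambda>_. 0) k' a a' = floquet_entry T q (\<lambda>_. 0) k a a'" for a a'
      unfolding floquet_entry_def
      by (subst floquet_extension_cong_quasimomentum[of T k' k]) (simp_all add: k'_def)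
    then have "mixed_entry T C q U k' z y = mixed_entry T C q U k z y" for U z
      by (intro ext) (simp add: mixed_entry_def)
    moreover have "k' \<in> tuples (T \<union> C)" by (simp add: k'_def)
    then have "floquet_det (T \<union> C) q V k' z\<^sub>1 = floquet_det (T \<union> C) q Y k' z\<^sub>2"
      using fermi unfolding generalized_fermi_isospectral_def by blast
    ultimately show "mixed_det V k z\<^sub>1 y - mixed_det Y k z\<^sub>2 y = 0"
      by (simp add: det)
  qed
  then show ?thesis by simp
qed

text \<open>
  Rows of nonzero frequency are divided by their energy and tend to unit rows; rows of frequency
  \<open>0\<close> are constant along the path.  What remains of the limit is the block of frequency \<open>0\<close>, in
  which the potential enters through its \<open>0\<close>-th Fourier coefficient, its average.  The
  normalising factor does not involve \<open>V\<close>, so it is the same for two potentials.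
\<close>

lemma mixed_det_tendsto:
  fixes y :: "nat \<Rightarrow> nat \<Rightarrow> complex" and \<mu> :: complex
  assumes low: "\<And>t. kinetic C q (\<lambda>l\<in>C. 0) (y t) = \<mu>"
    and high: "\<And>c. c \<in> fundamental_cell C q \<Longrightarrow> c \<noteq> (\<lambda>l\<in>C. 0) \<Longrightarrow>
       filterlim (\<lambda>t. kinetic C q c (y t)) at_infinity sequentially"
  shows "(\<lambda>t. (\<Prod>v\<in>fundamental_cell T q \<times> fundamental_cell C q.
              if snd v = (\<lambda>l\<in>C. 0) then 1 else 1 / kinetic C q (snd v) (y t)) * mixed_det V k z (y t))
         \<longlonglongrightarrow> floquet_det T q (\<lambda>n. cell_mean T C q V n - z) k (- \<mu>)"
proof -
  define A where "A = fundamental_cell T q"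
  define B where "B = fundamental_cell C q"
  have finA: "finite A" and finB: "finite B"
    unfolding A_def B_def by (simp_all add: finite_fundamental_cell finT finC)
  define origin where "origin = (\<lambda>l\<in>C. 0::int)"
  have origin: "origin \<in> B" unfolding B_def origin_def fundamental_cell_def using pos by auto
  define K where "K v t = kinetic C q (snd v) (y t)" for v :: "(nat \<Rightarrow> int) \<times> (nat \<Rightarrow> int)" and t
  define s where "s t v = (if snd v = origin then 1 else 1 / K v t)" for t and v :: "(nat \<Rightarrow> int) \<times> (nat \<Rightarrow> int)"
  define R where "R v w = of_bool (snd v = snd w) * (floquet_entry T q (\<lambda>_. 0) k (fst v) (fst w) - of_bool (fst v = fst w) * z)
      + of_bool (fst v = fst w) * fourier_coeff T C q V (fst v) (snd v) (snd w)" for v w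
  have M: "mixed_entry T C q V k z (y t) v w = of_bool (v = w) * K v t + R v w" for t v w
    unfolding K_def R_def by (rule mixed_entry_split)
  define L where "L v w = (if snd v = origin then of_bool (v = w) * \<mu> + R v w else of_bool (v = w))" for v w
  have "(\<lambda>t. det_on (A \<times> B) (\<lambda>v w. s t v * mixed_entry T C q V k z (y t) v w)) \<longlonglongrightarrow> det_on (A \<times> B) L"
  proof (rule tendsto_det_on)
    fix v w assume v: "v \<in> A \<times> B"
    show "(\<lambda>t. s t v * mixed_entry T C q V k z (y t) v w) \<longlonglongrightarrow> L v w"
    proof (cases "snd v = origin")
      case True
      then show ?thesis using low by (simp add: s_def M L_def K_def origin_def)
    next
      case False
      have inf: "filterlim (K v) at_infinity sequentially"
        unfolding K_def by (rule high) (use v False in \<open>auto simp: B_def origin_def\<close>)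
      have "(\<lambda>t. of_bool (v = w) + R v w / K v t) \<longlonglongrightarrow> of_bool (v = w) + 0"
        by (intro tendsto_add tendsto_const tendsto_divide_0[OF tendsto_const inf])
      moreover have "eventually (\<lambda>t. of_bool (v = w) + R v w / K v t = s t v * mixed_entry T C q V k z (y t) v w) sequentially"
        using filterlim_at_infinity_imp_eventually_ne[OF inf, of 0]
        by eventually_elim (use False in \<open>simp add: s_def M field_simps\<close>)
      ultimately show ?thesis using False by (simp add: L_def Lim_transform_eventually)
    qed
  qed
  then have "(\<lambda>t. (\<Prod>v\<in>A \<times> B. s t v) * mixed_det V k z (y t)) \<longlonglongrightarrow> det_on (A \<times> B) L"
    by (simp add: det_on_scale_rows A_def B_def)
  also have "det_on (A \<times> B) L = det_on (A \<times> {origin}) L"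
    by (rule det_on_unit_rows) (use finA finB origin in \<open>auto simp: L_def\<close>)
  also have "\<dots> = det_on A (\<lambda>a a'. L (a, origin) (a', origin))"
    by (rule det_on_reindex[where \<beta> = "\<lambda>a. (a, origin)", symmetric]) (use finA in \<open>auto simp: bij_betw_def inj_on_def\<close>)
  also have "\<dots> = floquet_det T q (\<lambda>n. cell_mean T C q V n - z) k (- \<mu>)"
    unfolding floquet_det_eq_det_on[OF finT] A_def[symmetric]
  proof (rule det_on_cong)
    fix a a' assume a: "a \<in> A"
    show "L (a, origin) (a', origin) =
        floquet_entry T q (\<lambda>n. cell_mean T C q V n - z) k a a' - (- \<mu>) * of_bool (a = a')"
      using a unfolding A_def
      by (simp add: floquet_entry_potential[of a T q "\<lambda>n. cell_mean T C q V n - z"] L_def R_def fourier_coeff_diagonal)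
  qed
  finally show ?thesis unfolding A_def B_def s_def K_def origin_def .
qed

lemma floquet_det_cell_mean_eq:
  assumes card: "card C \<ge> 2" and cop: "pairwise (\<lambda>i j. coprime (q i) (q j)) C"
    and fermi: "generalized_fermi_isospectral (T \<union> C) q V z\<^sub>1 Y z\<^sub>2"
  shows "floquet_det T q (\<lambda>n. cell_mean T C q V n - z\<^sub>1) k z =
    floquet_det T q (\<lambda>n. cell_mean T C q Y n - z\<^sub>2) k z"
proof -
  obtain y :: "nat \<Rightarrow> nat \<Rightarrow> complex" where
    y: "\<And>t l. l \<in> C \<Longrightarrow> y t l \<noteq> 0"
    and low: "\<And>t. kinetic C q (\<lambda>l\<in>C. 0) (y t) = - z"
    and high: "\<And>c. c \<in> fundamental_cell C q \<Longrightarrow> c \<noteq> (\<lambda>l\<in>C. 0) \<Longrightarrow>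
       filterlim (\<lambda>t. kinetic C q c (y t)) at_infinity sequentially"
    using kinetic_path[OF finC card cop, of "- z"] by blast
  have eq: "mixed_det V k z\<^sub>1 (y t) = mixed_det Y k z\<^sub>2 (y t)" for t
    by (rule mixed_det_eq_of_fermi[OF fermi]) (use y in blast)
  show ?thesis
    using LIMSEQ_unique[OF mixed_det_tendsto[OF low high, of V k z\<^sub>1, unfolded eq]
        mixed_det_tendsto[OF low high, of Y k z\<^sub>2]] by simp
qed

text \<open>
  Fermi isospectrality at a single pair of energies already determines the averages at all
  energies: the missing spectral parameter is recovered from the energy \<open>\<mu>\<close> that is free to
  choose in the eliminated directions.
\<close>

theorem floquet_isospectral_cell_mean:
  assumes "card C \<ge> 2" "pairwise (\<lambda>i j. coprime (q i) (q j)) C"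
    and "lattice_periodic (T \<union> C) q V" "lattice_periodic (T \<union> C) q Y"
    and "generalized_fermi_isospectral (T \<union> C) q V z\<^sub>1 Y z\<^sub>2"
  shows "floquet_isospectral T q (\<lambda>n. cell_mean T C q V n - z\<^sub>1) (\<lambda>n. cell_mean T C q Y n - z\<^sub>2)"
  unfolding floquet_isospectral_def
  using lattice_periodic_cell_mean[OF assms(3), of "- z\<^sub>1"] lattice_periodic_cell_mean[OF assms(4), of "- z\<^sub>2"]
    floquet_det_cell_mean_eq[OF assms(1,2,5)] by simp

end

section \<open>Separable potentials\<close>

lemma sum_upto_block:
  fixes ds :: "nat \<Rightarrow> nat"
  assumes "m \<ge> 1"
  shows "(\<Sum>j = 1..m. ds j) = (\<Sum>j = 1..<m. ds j) + ds m"
  using assms by (cases m) (simp_all add: atLeastLessThanSuc_atLeastAtMost)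

lemma card_block: "m \<ge> 1 \<Longrightarrow> card (block ds m) = ds m"
  using sum_upto_block[of m ds] by (simp add: block_def)

lemma block_subset:
  assumes "m \<le> r"
  shows "block ds m \<subseteq> {1..\<Sum>j = 1..r. ds j}"
proof -
  have "(\<Sum>j = 1..m. ds j) \<le> (\<Sum>j = 1..r. ds j)" using assms by (intro sum_mono2) auto
  then show ?thesis unfolding block_def by auto
qed

lemma block_disjoint:
  assumes "i \<noteq> j"
  shows "block ds i \<inter> block ds j = {}"
proof -
  have *: "block ds i \<inter> block ds j = {}" if "i < j" for i j
  proof -
    have "(\<Sum>l = 1..i. ds l) \<le> (\<Sum>l = 1..<j. ds l)" using that by (intro sum_mono2) auto
    then show ?thesis by (auto simp: block_def)
  qed
  show ?thesis using assms *[of i j] *[of j i] by (cases i j rule: linorder_cases) (simp_all add: Int_commute)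
qed

lemma floquet_isospectral_cong:
  assumes S: "finite S"
    and VV: "\<And>n. n \<in> tuples S \<Longrightarrow> V n = V' n" and YY: "\<And>n. n \<in> tuples S \<Longrightarrow> Y n = Y' n"
    and iso: "floquet_isospectral S q V Y"
  shows "floquet_isospectral S q V' Y'"
proof -
  have per: "lattice_periodic S q V" "lattice_periodic S q Y"
    and det: "\<forall>k\<in>tuples S. \<forall>z. floquet_det S q V k z = floquet_det S q Y k z"
    using iso unfolding floquet_isospectral_def by simp_all
  have detV: "floquet_det S q V k z = floquet_det S q V' k z" for k z
    by (rule floquet_det_cong_potential[OF S VV])
  have detY: "floquet_det S q Y k z = floquet_det S q Y' k z" for k z
    by (rule floquet_det_cong_potential[OF S YY])
  show ?thesis
    unfolding floquet_isospectral_def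
    using lattice_periodic_cong[OF VV per(1)] lattice_periodic_cong[OF YY per(2)] det[unfolded detV detY]
    by blast
qed

text \<open>
  The parts \<open>B i\<close> with \<open>i \<noteq> j\<close> lie in the averaged coordinates, so of the summand \<open>Vs i\<close> only the
  dependence on the coordinates in \<open>D\<close> survives.
\<close>

lemma cell_mean_separable:
  assumes C: "finite C" "\<And>l. l \<in> C \<Longrightarrow> q l > 0"
    and J: "finite J" "j \<in> J" and T: "T = B j \<union> D" and disj: "T \<inter> C = {}"
    and B: "\<And>i. i \<in> J - {j} \<Longrightarrow> B i \<subseteq> C"
    and V: "\<And>n. n \<in> tuples (T \<union> C) \<Longrightarrow> V n = (\<Sum>i\<in>J. Vs i (restrict n (B i \<union> D)))"
    and n: "n \<in> tuples T"
  shows "cell_mean T C q V n =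
    Vs j n + (\<Sum>i\<in>J - {j}. cell_mean T C q (\<lambda>x. Vs i (restrict x (B i \<union> D))) (restrict n D))"
proof -
  let ?W = "fundamental_cell C q"
  have W: "(of_nat (card ?W) :: complex) \<noteq> 0"
    using C by (simp add: card_fundamental_cell)
  have "V (join T n x) = Vs j n + (\<Sum>i\<in>J - {j}. Vs i (restrict (join T (restrict n D) x) (B i \<union> D)))"
    if x: "x \<in> ?W" for x
  proof -
    have "join T n x \<in> tuples (T \<union> C)"
      using n x by (auto simp: fundamental_cell_def join_def PiE_iff extensional_def)
    then have "V (join T n x) = Vs j (restrict (join T n x) (B j \<union> D)) +
        (\<Sum>i\<in>J - {j}. Vs i (restrict (join T n x) (B i \<union> D)))"
      using V by (simp only: sum.remove[OF J])
    moreover have "restrict (join T n x) (B j \<union> D) = n"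
      using n unfolding T[symmetric] by (auto simp: join_def fun_eq_iff PiE_iff extensional_def)
    moreover have "restrict (join T n x) (B i \<union> D) = restrict (join T (restrict n D) x) (B i \<union> D)"
      if "i \<in> J - {j}" for i
      using B[OF that] disj T by (auto simp: join_def fun_eq_iff)
    ultimately show ?thesis by simp
  qed
  then have "(\<Sum>x\<in>?W. V (join T n x)) = of_nat (card ?W) * Vs j n +
      (\<Sum>x\<in>?W. \<Sum>i\<in>J - {j}. Vs i (restrict (join T (restrict n D) x) (B i \<union> D)))"
    by (simp add: sum.distrib)
  also have "(\<Sum>x\<in>?W. \<Sum>i\<in>J - {j}. Vs i (restrict (join T (restrict n D) x) (B i \<union> D))) =
      (\<Sum>i\<in>J - {j}. \<Sum>x\<in>?W. Vs i (restrict (join T (restrict n D) x) (B i \<union> D)))"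
    by (rule sum.swap)
  finally show ?thesis
    unfolding cell_mean_def using W by (simp add: add_divide_distrib sum_divide_distrib)
qed

theorem theorem3p5:
  fixes r d :: nat and ds q :: "nat \<Rightarrow> nat"
    and V Y :: "(nat \<Rightarrow> int) \<Rightarrow> complex"
    and Vs Ys :: "nat \<Rightarrow> (nat \<Rightarrow> int) \<Rightarrow> complex"
    and z\<^sub>1 z\<^sub>2 :: complex
  assumes "d = (\<Sum>j = 1..r. ds j)"
    and "r \<ge> 3"
    and "\<forall>j\<in>{1..r}. ds j \<ge> 1"
    and "\<forall>j\<in>{1..r-1}. int d - int (ds j) - int (ds r) \<ge> 2"
    and "\<forall>i\<in>{1..d}. q i > 0"
    and "pairwise (\<lambda>i j. coprime (q i) (q j)) {1..d}"
    and "lattice_periodic {1..d} q V"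
    and "lattice_periodic {1..d} q Y"
    and "generalized_fermi_isospectral {1..d} q V z\<^sub>1 Y z\<^sub>2"
    and "\<forall>n\<in>tuples {1..d}. V n = (\<Sum>j = 1..r-1. Vs j (restrict n (block ds j \<union> block ds r)))"
    and "\<forall>n\<in>tuples {1..d}. Y n = (\<Sum>j = 1..r-1. Ys j (restrict n (block ds j \<union> block ds r)))"
  shows "\<forall>j\<in>{1..r-1}. \<exists>U\<^sub>1 U\<^sub>2 :: (nat \<Rightarrow> int) \<Rightarrow> complex.
           floquet_isospectral (block ds j \<union> block ds r) q
             (\<lambda>n. Vs j n + U\<^sub>1 (restrict n (block ds r)))
             (\<lambda>n. Ys j n + U\<^sub>2 (restrict n (block ds r)))"
proof
  fix j assume j: "j \<in> {1..r-1}"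
  define D where "D = block ds r"
  define T where "T = block ds j \<union> D"
  define C where "C = {1..d} - T"
  have jr: "j \<noteq> r" "1 \<le> j" "j \<le> r" "1 \<le> r" using j \<open>r \<ge> 3\<close> by auto
  have sub: "block ds i \<subseteq> {1..d}" if "i \<le> r" for i
    using block_subset[OF that, of ds] by (simp add: assms(1))
  have Tsub: "T \<subseteq> {1..d}" using sub jr by (simp add: T_def D_def)
  then have TC: "T \<union> C = {1..d}" and disj: "T \<inter> C = {}" by (auto simp: C_def)
  have finT: "finite T" using Tsub finite_subset by blast
  have "finite (block ds i)" for i by (simp add: block_def)
  then have "card T = card (block ds j) + card (block ds r)"
    unfolding T_def D_def by (intro card_Un_disjoint block_disjoint jr)
  then have "card T = ds j + ds r" using card_block jr by metis
  then have "card C = d - (ds j + ds r)"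
    unfolding C_def using card_Diff_subset[OF finT Tsub] by simp
  moreover have "int d - int (ds j) - int (ds r) \<ge> 2" using assms(4) j by blast
  ultimately have card: "card C \<ge> 2" by linarith
  have cop: "pairwise (\<lambda>i j. coprime (q i) (q j)) C"
    using assms(6) by (rule pairwise_subset) (simp add: C_def)
  interpret split_lattice T C q
  proof
    show "q l > 0" if "l \<in> T \<union> C" for l using that assms(5) unfolding TC by blast
  qed (use finT disj in \<open>simp_all add: C_def\<close>)
  have B: "block ds i \<subseteq> C" if i: "i \<in> {1..r-1} - {j}" for i
  proof -
    have ir: "i \<le> r" "i \<noteq> j" "i \<noteq> r" using i \<open>r \<ge> 3\<close> by auto
    show ?thesis
      using sub[OF ir(1)] block_disjoint[OF ir(2), of ds] block_disjoint[OF ir(3), of ds]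
      unfolding C_def T_def D_def by blast
  qed
  define U where "U Vs z m = (\<Sum>i\<in>{1..r-1} - {j}.
      cell_mean T C q (\<lambda>x. Vs i (restrict x (block ds i \<union> D))) m) - z"
    for Vs :: "nat \<Rightarrow> (nat \<Rightarrow> int) \<Rightarrow> complex" and z m
  have mean: "cell_mean T C q V n - z = Vs j n + U Vs z (restrict n D)"
    if V: "\<forall>n\<in>tuples {1..d}. V n = (\<Sum>j = 1..r-1. Vs j (restrict n (block ds j \<union> block ds r)))"
      and n: "n \<in> tuples T" for V Vs z n
  proof -
    have "cell_mean T C q V n = Vs j n + (\<Sum>i\<in>{1..r-1} - {j}.
        cell_mean T C q (\<lambda>x. Vs i (restrict x (block ds i \<union> D))) (restrict n D))"
    proof (rule cell_mean_separable[where B = "block ds" and J = "{1..r-1}", OF finC])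
      show "V n = (\<Sum>i\<in>{1..r-1}. Vs i (restrict n (block ds i \<union> D)))" if "n \<in> tuples (T \<union> C)" for n
        using V that unfolding TC D_def by blast
      show "block ds i \<subseteq> C" if "i \<in> {1..r-1} - {j}" for i by (rule B[OF that])
    qed (use pos disj j n in \<open>simp_all add: T_def\<close>)
    then show ?thesis by (simp add: U_def)
  qed
  have iso: "floquet_isospectral T q (\<lambda>n. cell_mean T C q V n - z\<^sub>1) (\<lambda>n. cell_mean T C q Y n - z\<^sub>2)"
    by (rule floquet_isospectral_cell_mean[OF card cop, unfolded TC, OF assms(7-9)])
  have "floquet_isospectral T q (\<lambda>n. Vs j n + U Vs z\<^sub>1 (restrict n D)) (\<lambda>n. Ys j n + U Ys z\<^sub>2 (restrict n D))"
    by (rule floquet_isospectral_cong[OF finT mean[OF assms(10)] mean[OF assms(11)] iso])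
  then show "\<exists>U\<^sub>1 U\<^sub>2 :: (nat \<Rightarrow> int) \<Rightarrow> complex.
           floquet_isospectral (block ds j \<union> block ds r) q
             (\<lambda>n. Vs j n + U\<^sub>1 (restrict n (block ds r)))
             (\<lambda>n. Ys j n + U\<^sub>2 (restrict n (block ds r)))"
    unfolding T_def D_def by (intro exI[of _ "U Vs z\<^sub>1"] exI[of _ "U Ys z\<^sub>2"])
qed

end
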